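(* Let $m\in\mathbb{Z}^+$, let $p_1,\dots,p_m,q,r>0$ satisfy $\frac1q+\frac1r=1$ and $\sum_{j=1}^m p_j=1$, and for each $1\le j\le m$ let $P_j,Q_j$ be coprime integers with $Q_j\ne 0$; put $B_j(x,y)=\frac{1}{\sqrt{P_j^2+Q_j^2}}(P_jx+Q_jy)$ for $(x,y)\in\mathbb{R}^2$. Suppose that every torsion-free abelian group $G$ satisfies the restricted weak type counterpart for the data $(m,p_j,q,r,P_j,Q_j)$ with a uniform implied constant (independent of $G$). Then there is a finite constant $C$ such that for all (measurable, integrable) functions $f_1,\dots,f_m:\mathbb{R}\to[0,\infty)$, $$\left\|\prod_{j=1}^m f_j(B_j(x,y))^{p_j}\right\|_{L_x^qL_y^r}\le C\prod_{j=1}^m\|f_j\|_{L^1}^{p_j}.$$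
   Context: The mixed norm is $\|F\|_{L_x^qL_y^r}=\left(\int_{\mathbb{R}}\left(\int_{\mathbb{R}}|F(x,y)|^r\,dy\right)^{q/r}dx\right)^{1/q}$. The map $B_j$ is the orthogonal projection of $\mathbb{R}^2$ onto the line $H_j$ spanned by $(P_j,Q_j)$, with $H_j$ identified with $\mathbb{R}$; the condition $Q_j\neq 0$ says that $H_j$ is not the $x$-axis. Restricted weak type counterpart: abelian groups $G$ are regarded as discrete and $|\cdot|$ denotes cardinality. We say that every torsion-free abelian group satisfies the restricted weak type counterpart for the data $(m,p_j,q,r,P_j,Q_j)$ with a uniform implied constant if there is a constant $C_0<\infty$ such that for every torsion-free abelian group $G$, all finite subsets $S_1,\dots,S_m\subset G$, every real $M\ge 1$ and every finite $Z\subset G^2$ such that (i) $P_jz_1+Q_jz_2\in S_j$ for all $(z_1,z_2)\in Z$ and all $1\le j\le m$, and (ii) for every $g\in G$, the number of elements of $Z$ of the form $(g,\cdot)$ is either $0$ or $\sim M$ (i.e. lies between $M$ and $2M$; other fixed comparability constants give an equivalent condition), one has $|Z|\le C_0\, M^{1-\frac qr}\prod_{j=1}^m|S_j|^{p_jq}$. *)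

theory Defs
  imports
    "HOL-Analysis.Analysis"
    "HOL-Algebra.Group"
    "HOL-Library.Infinite_Typeclass"
begin

section \<open>Mixed norms\<close>

text \<open>Powers on \<open>[0,\<infinity>]\<close>; only used with exponents \<open>a > 0\<close>, where \<open>\<infinity> ^ a = \<infinity>\<close> and
  \<open>0 ^ a = 0\<close> (the latter agrees with \<open>0 powr a = 0\<close>).\<close>

definition ennpowr :: "ennreal \<Rightarrow> real \<Rightarrow> ennreal" where
  "ennpowr t a = (if t = \<infinity> then \<infinity> else ennreal (enn2real t powr a))"

definition mixed_norm :: "real \<Rightarrow> real \<Rightarrow> (real \<Rightarrow> real \<Rightarrow> real) \<Rightarrow> ennreal" where
  "mixed_norm q r F =
     ennpowr
       (\<integral>\<^sup>+ x. ennpowr (\<integral>\<^sup>+ y. ennreal (\<bar>F x y\<bar> powr r) \<partial>lebesgue) (q / r) \<partial>lebesgue)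
       (1 / q)"

definition L1_norm :: "(real \<Rightarrow> real) \<Rightarrow> real" where
  "L1_norm f = (LINT x|lebesgue. \<bar>f x\<bar>)"

text \<open>The orthogonal projection of the plane onto the line spanned by \<open>(a, b)\<close>, as the signed
  coordinate along the unit vector in that direction.\<close>

definition line_proj :: "int \<Rightarrow> int \<Rightarrow> real \<Rightarrow> real \<Rightarrow> real" where
  "line_proj a b x y =
     (1 / sqrt ((of_int a)\<^sup>2 + (of_int b)\<^sup>2)) * (of_int a * x + of_int b * y)"

section \<open>The restricted weak type counterpart on an abelian group\<close>

text \<open>Abelian groups are the commutative groups of \<open>HOL-Algebra\<close>, hence written
  multiplicatively: \<open>a z\<^sub>1 + b z\<^sub>2\<close> becomes \<open>z\<^sub>1 [^] a \<otimes> z\<^sub>2 [^] b\<close>.\<close>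

definition torsion_free_abelian :: "'g monoid \<Rightarrow> bool" where
  "torsion_free_abelian G \<longleftrightarrow>
     comm_group G \<and>
     (\<forall>x\<in>carrier G. \<forall>n::nat. n > 0 \<longrightarrow> x [^]\<^bsub>G\<^esub> n = \<one>\<^bsub>G\<^esub> \<longrightarrow> x = \<one>\<^bsub>G\<^esub>)"

definition restricted_weak_type ::
  "'g monoid \<Rightarrow> nat \<Rightarrow> (nat \<Rightarrow> real) \<Rightarrow> real \<Rightarrow> real \<Rightarrow> (nat \<Rightarrow> int) \<Rightarrow> (nat \<Rightarrow> int) \<Rightarrow> real \<Rightarrow> bool"
where
  "restricted_weak_type G m p q r P Q C0 \<longleftrightarrow>
     (\<forall>(S :: nat \<Rightarrow> 'g set) (M :: real) (Z :: ('g \<times> 'g) set).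
        (\<forall>j\<in>{1..m}. finite (S j) \<and> S j \<subseteq> carrier G) \<longrightarrow>
        1 \<le> M \<longrightarrow>
        finite Z \<longrightarrow> Z \<subseteq> carrier G \<times> carrier G \<longrightarrow>
        (\<forall>(z1, z2)\<in>Z. \<forall>j\<in>{1..m}. z1 [^]\<^bsub>G\<^esub> P j \<otimes>\<^bsub>G\<^esub> z2 [^]\<^bsub>G\<^esub> Q j \<in> S j) \<longrightarrow>
        (\<forall>g\<in>carrier G.
           card {z\<in>Z. fst z = g} = 0 \<or>
           M \<le> real (card {z\<in>Z. fst z = g}) \<and> real (card {z\<in>Z. fst z = g}) \<le> 2 * M) \<longrightarrow>
        real (card Z) \<le> C0 * M powr (1 - q / r) * (\<Prod>j=1..m. real (card (S j)) powr (p j * q)))"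

text \<open>HOL cannot quantify over types inside a formula, so the groups range over all
  torsion-free abelian groups whose carrier is a subset of a type \<open>'g\<close>, for an arbitrary infinite
  type \<open>'g\<close>. This is no restriction: an instance of the inequality only involves the subgroup
  generated by the finitely many coordinates of \<open>Z\<close> and elements of the \<open>S j\<close>, which is countable
  and hence isomorphic to a group carried by a subset of \<open>'g\<close>. So the property below does not
  depend on the choice of \<open>'g\<close>. (For a finite \<open>'g\<close> only trivial groups would be torsion-free.)\<close>

definition uniform_restricted_weak_type ::
  "'g::infinite itself \<Rightarrow> nat \<Rightarrow> (nat \<Rightarrow> real) \<Rightarrow> real \<Rightarrow> real \<Rightarrow> (nat \<Rightarrow> int) \<Rightarrow> (nat \<Rightarrow> int) \<Rightarrow> bool"
where
  "uniform_restricted_weak_type (TYPE('g)) m p q r P Q \<longleftrightarrow>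
     (\<exists>C0::real. \<forall>G :: 'g monoid.
        torsion_free_abelian G \<longrightarrow> restricted_weak_type G m p q r P Q C0)"

end

theory Submission
  imports Defs "HOL-Algebra.Product_Groups" "HOL-Real_Asymp.Real_Asymp"
begin

text \<open>Tensor power trick: splitting functions on \<open>\<int>\<^sup>n\<close> into level sets and fibre counts into dyadic
  ranges, the restricted weak type bound gives the strong one with a loss controlled by the number of
  pieces. For an \<open>n\<close>-fold tensor power of functions on \<open>\<int>\<close> that number is polynomial in \<open>n\<close>, so taking
  \<open>n\<close>-th roots yields the strong type inequality on \<open>\<int>\<close> with constant 1. It is carried over to \<open>\<real>\<close> by
  replacing lower semicontinuous majorants of the \<open>f\<^sub>j\<close> with their infima over the cells of the grid
  \<open>N\<^sup>-\<^sup>1\<int>\<close>; these have no larger integral and converge from below, so Fatou's lemma applies.\<close>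

section \<open>From restricted weak type to strong type with loss\<close>

text \<open>The loss for a single grid depends on the number of levels and on \<open>card Y\<close>,
  so it would blow up as the mesh shrinks. The tensor power trick removes exactly this dependence,
  and it needs one \<open>C0\<close> valid for all powers Z^n: then \<open>C0\<close> stays inside a
  factor polynomial in n. The passage to the line works because the inequality is scale invariant.
  With mesh 1/N the left side, raised to the power q, carries N^(-1) N^(-q/r) = N^(-q) because 1/q +
  1/r = 1, and the right side carries N^(-q) because the \<open>p j\<close> sum to 1. Hence every
  mesh gives the same bound. Infima over cells cannot be taken of \<open>f j\<close> itself: an
  integrable function vanishing on a dense set has all these infima 0. Lower semicontinuity of the
  majorant is what makes the infima recover at least \<open>f j\<close> in the limit. The final
  constant is the product of (2 sqrt(P_j^2 + Q_j^2))^(p_j): the 2 is the price of the majorant, the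
  root is the normalisation of the projection.\<close>

text \<open>Every term is at most the maximum, whose power is one of the summands on the right. This
  treats \<open>s < 1\<close> and \<open>s >= 1\<close> alike; the crude factor is affordable
  because \<open>A\<close> will be a set of polynomially many level tuples.\<close>

lemma powr_sum_le_card_powr_sum:
  fixes a :: "'a \<Rightarrow> real"
  assumes fin: "finite A" and a: "\<And>i. i \<in> A \<Longrightarrow> a i \<ge> 0" and s: "s > 0"
  shows "(\<Sum>i\<in>A. a i) powr s \<le> real (card A) powr s * (\<Sum>i\<in>A. a i powr s)"
proof (cases "A = {}")
  case False
  define M where "M = Max (a ` A)"
  have "M \<in> a ` A" unfolding M_def using fin False by auto
  then obtain i where i: "i \<in> A" "a i = M" by auto
  have "(\<Sum>i\<in>A. a i) \<le> real (card A) * M"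
    using fin by (intro sum_bounded_above) (auto simp: M_def)
  then have "(\<Sum>i\<in>A. a i) powr s \<le> (real (card A) * M) powr s"
    using s a by (intro powr_mono2) (auto intro: sum_nonneg)
  also have "\<dots> = real (card A) powr s * a i powr s"
    using a i by (simp add: powr_mult)
  also have "a i powr s \<le> (\<Sum>i\<in>A. a i powr s)"
    using fin i by (intro member_le_sum) auto
  finally show ?thesis by (simp add: mult_left_mono)
qed simp

text \<open>Since \<open>c / 2 ^ k\<close> lies in [1, 2], its power \<open>s - 1\<close> is at most
  2^|s-1| for either sign of \<open>s - 1\<close>. The bound is linear in \<open>c\<close>, so that
  summing it over fibres produces the cardinality of a set of pairs.\<close>

lemma powr_le_dyadic:
  fixes c :: real
  assumes k: "2 ^ k \<le> c" "c \<le> 2 * 2 ^ k"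
  shows "c powr s \<le> c * (2 powr \<bar>s - 1\<bar> * (2 ^ k) powr (s - 1))"
proof -
  have c: "c > 0" using k(1) by (rule less_le_trans[rotated]) simp
  have "(c / 2 ^ k) powr (s - 1) \<le> 2 powr \<bar>s - 1\<bar>"
  proof (cases "s \<ge> 1")
    case True
    then show ?thesis using k c by (auto intro!: powr_mono2 simp: divide_simps)
  next
    case False
    then have "(c / 2 ^ k) powr (s - 1) \<le> 1 powr (s - 1)"
      using k c by (intro powr_mono2') (auto simp: divide_simps)
    also have "\<dots> \<le> 2 powr \<bar>s - 1\<bar>" by (simp add: ge_one_powr_ge_zero)
    finally show ?thesis .
  qed
  then have "c powr (s - 1) \<le> 2 powr \<bar>s - 1\<bar> * (2 ^ k) powr (s - 1)"
    using c by (simp add: powr_divide divide_simps split: if_splits)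
  moreover have "c powr s = c * c powr (s - 1)"
    using c by (simp add: powr_diff)
  ultimately show ?thesis using c by (simp add: mult_left_mono)
qed

lemma ex_dyadic_nat:
  fixes c :: nat
  assumes "c > 0" "c \<le> 2 ^ K"
  shows "\<exists>k\<le>K. 2 ^ k \<le> c \<and> c \<le> 2 * 2 ^ k"
proof -
  obtain k where k: "2 ^ k \<le> c" "c < 2 ^ Suc k"
    using ex_power_ivl1[of 2 c] assms(1) by auto
  have "(2::nat) ^ k \<le> 2 ^ K" using k(1) assms(2) by linarith
  then have "k \<le> K" by simp
  with k show ?thesis by auto
qed

text \<open>The hypothesis is applied to each piece with a fixed tuple of levels and a fixed dyadic
  range of fibre counts. There are at most \<open>L ^ m\<close> tuples and \<open>K + 1\<close>
  ranges. The number of tuples enters twice: to the power \<open>q / r\<close> when the inner sum is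
  split, and once more when the pieces are added.\<close>

lemma restricted_weak_type_imp_lossy_strong_type:
  fixes F :: "nat \<Rightarrow> 'g \<Rightarrow> real"
  assumes rwt: "restricted_weak_type G m p q r P Q C0"
    and q: "q > 0" and r: "r > 0"
    and X: "finite X" "X \<subseteq> carrier G" and Y: "finite Y" "Y \<subseteq> carrier G"
    and N: "\<And>j. j \<in> {1..m} \<Longrightarrow> finite (N j)" "\<And>j. j \<in> {1..m} \<Longrightarrow> N j \<subseteq> carrier G"
    and maps: "\<And>x y j. x \<in> X \<Longrightarrow> y \<in> Y \<Longrightarrow> j \<in> {1..m} \<Longrightarrow>
      x [^]\<^bsub>G\<^esub> P j \<otimes>\<^bsub>G\<^esub> y [^]\<^bsub>G\<^esub> Q j \<in> N j"
    and F: "\<And>j z. F j z \<ge> 0"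
    and p: "\<And>j. j \<in> {1..m} \<Longrightarrow> p j > 0"
    and L: "\<And>j. j \<in> {1..m} \<Longrightarrow> card (F j ` N j) \<le> L"
    and K: "card Y \<le> 2 ^ K"
  shows "(\<Sum>x\<in>X. (\<Sum>y\<in>Y. \<Prod>j=1..m.
            F j (x [^]\<^bsub>G\<^esub> P j \<otimes>\<^bsub>G\<^esub> y [^]\<^bsub>G\<^esub> Q j) powr (p j * r)) powr (q / r))
    \<le> \<bar>C0\<bar> * 2 powr \<bar>q / r - 1\<bar> * real (K + 1) * real (L ^ m) powr (q / r + 1)
       * (\<Prod>j=1..m. (\<Sum>z\<in>N j. F j z) powr (p j * q))"
proof -
  define s where "s = q / r"
  have s: "s > 0" using q r by (simp add: s_def)
  define B where "B j x y = x [^]\<^bsub>G\<^esub> P j \<otimes>\<^bsub>G\<^esub> y [^]\<^bsub>G\<^esub> Q j" for j x y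
  define \<Lambda> where "\<Lambda> = (\<Pi>\<^sub>E j\<in>{1..m}. F j ` N j)"
  define fib where "fib l x = {y\<in>Y. \<forall>j\<in>{1..m}. F j (B j x y) = l j}" for l x
  define R where "R = (\<Prod>j=1..m. (\<Sum>z\<in>N j. F j z) powr (p j * q))"
  have R0: "R \<ge> 0" unfolding R_def by (intro prod_nonneg) auto
  have fin\<Lambda>: "finite \<Lambda>" unfolding \<Lambda>_def using N by (intro finite_PiE) auto
  have "card \<Lambda> = (\<Prod>j=1..m. card (F j ` N j))"
    unfolding \<Lambda>_def by (subst card_PiE) auto
  also have "\<dots> \<le> (\<Prod>j=1..m. L)" using L by (intro prod_mono) auto
  finally have card\<Lambda>: "card \<Lambda> \<le> L ^ m" by simp
  have finfib: "finite (fib l x)" for l x unfolding fib_def using Y by auto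
  have inner: "(\<Sum>y\<in>Y. \<Prod>j=1..m. F j (B j x y) powr (p j * r))
      = (\<Sum>l\<in>\<Lambda>. real (card (fib l x)) * (\<Prod>j=1..m. l j powr (p j * r)))"
    if x: "x \<in> X" for x
  proof -
    define lev where "lev y = (\<lambda>j\<in>{1..m}. F j (B j x y))" for y
    have img: "lev ` Y \<subseteq> \<Lambda>"
      unfolding lev_def \<Lambda>_def using maps[OF x] by (auto simp: B_def)
    \<comment> \<open>Both functions are \<open>undefined\<close> outside \<open>{1..m}\<close>, so
      agreement on the indices is equality.\<close>
    have fibeq: "{y\<in>Y. lev y = l} = fib l x" if "l \<in> \<Lambda>" for l
      using that unfolding lev_def fib_def \<Lambda>_def
      by (auto simp: fun_eq_iff PiE_iff extensional_def restrict_def)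
    have "(\<Sum>y\<in>Y. \<Prod>j=1..m. F j (B j x y) powr (p j * r))
      = (\<Sum>l\<in>\<Lambda>. \<Sum>y\<in>{y\<in>Y. lev y = l}. \<Prod>j=1..m. F j (B j x y) powr (p j * r))"
      by (rule sum.group[symmetric]) (use Y fin\<Lambda> img in auto)
    also have "\<dots> = (\<Sum>l\<in>\<Lambda>. \<Sum>y\<in>fib l x. \<Prod>j=1..m. l j powr (p j * r))"
    proof (rule sum.cong[OF refl])
      fix l assume l: "l \<in> \<Lambda>"
      show "(\<Sum>y\<in>{y\<in>Y. lev y = l}. \<Prod>j=1..m. F j (B j x y) powr (p j * r))
          = (\<Sum>y\<in>fib l x. \<Prod>j=1..m. l j powr (p j * r))"
        unfolding fibeq[OF l] by (intro sum.cong prod.cong refl) (auto simp: fib_def)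
    qed
    finally show ?thesis by simp
  qed
  have level: "(\<Prod>j=1..m. l j powr (p j * q)) * (\<Sum>x\<in>X. real (card (fib l x)) powr s)
      \<le> \<bar>C0\<bar> * 2 powr \<bar>s - 1\<bar> * real (K + 1) * R" if l: "l \<in> \<Lambda>" for l
  proof -
    define S where "S j = {z\<in>N j. F j z = l j}" for j
    define Xk where "Xk k = {x\<in>X. (2::nat) ^ k \<le> card (fib l x) \<and> card (fib l x) \<le> 2 * 2 ^ k}" for k :: nat
    define T where "T = (\<Prod>j=1..m. real (card (S j)) powr (p j * q))"
    have T0: "T \<ge> 0" unfolding T_def by (intro prod_nonneg) auto
    have l0: "l j \<ge> 0" if "j \<in> {1..m}" for j
    proof -
      have "l j \<in> F j ` N j" using l that unfolding \<Lambda>_def by (rule PiE_mem)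
      then show ?thesis using F by auto
    qed
    have dyadic: "(\<Sum>x\<in>Xk k. real (card (fib l x)) powr s) \<le> \<bar>C0\<bar> * 2 powr \<bar>s - 1\<bar> * T" for k
    proof -
      \<comment> \<open>The fibre of \<open>Z\<close> over a point of \<open>Xk k\<close> has
        between 2^k and 2 * 2^k elements and all other fibres are empty, which is condition (ii)
        with M = 2^k.\<close>
      define Z where "Z = (SIGMA x:Xk k. fib l x)"
      have finZ: "finite Z" unfolding Z_def Xk_def using X finfib by auto
      have fibre: "{z\<in>Z. fst z = g} = (if g \<in> Xk k then Pair g ` fib l g else {})" for g
        unfolding Z_def by auto
      have cardfibre: "card {z\<in>Z. fst z = g} = (if g \<in> Xk k then card (fib l g) else 0)" for g
        unfolding fibre by (auto simp: card_image inj_on_def)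
      have Ssub: "finite (S j) \<and> S j \<subseteq> carrier G" if "j \<in> {1..m}" for j
        using N[OF that] unfolding S_def by auto
      have Zsub: "Z \<subseteq> carrier G \<times> carrier G"
        using X Y unfolding Z_def Xk_def fib_def by auto
      have ZS: "z1 [^]\<^bsub>G\<^esub> P j \<otimes>\<^bsub>G\<^esub> z2 [^]\<^bsub>G\<^esub> Q j \<in> S j"
        if "(z1, z2) \<in> Z" "j \<in> {1..m}" for z1 z2 j
        using that maps[of z1 z2 j] unfolding Z_def Xk_def fib_def S_def B_def by auto
      have ZM: "card {z\<in>Z. fst z = g} = 0 \<or>
          2 ^ k \<le> real (card {z\<in>Z. fst z = g}) \<and> real (card {z\<in>Z. fst z = g}) \<le> 2 * 2 ^ k" for g
      proof (cases "g \<in> Xk k")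
        case True
        then have "2 ^ k \<le> card (fib l g)" "card (fib l g) \<le> 2 * 2 ^ k" by (auto simp: Xk_def)
        then have "real (2 ^ k) \<le> real (card (fib l g))" "real (card (fib l g)) \<le> real (2 * 2 ^ k)"
          by (simp_all only: of_nat_le_iff)
        with True show ?thesis by (simp add: cardfibre)
      qed (simp add: cardfibre)
      have "real (card Z) \<le> C0 * (2 ^ k) powr (1 - q / r) * (\<Prod>j=1..m. real (card (S j)) powr (p j * q))"
        by (rule rwt[unfolded restricted_weak_type_def, rule_format, of S "2 ^ k" Z])
          (use finZ Ssub Zsub ZS ZM in \<open>auto split: prod.splits\<close>)
      \<comment> \<open>The sign of \<open>C0\<close> is unknown; its absolute value keeps the later
        monotonicity steps valid.\<close>
      also have "\<dots> \<le> \<bar>C0\<bar> * (2 ^ k) powr (1 - s) * T"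
        unfolding T_def[symmetric] s_def[symmetric] using T0 by (intro mult_right_mono) auto
      finally have Zle: "real (card Z) \<le> \<bar>C0\<bar> * (2 ^ k) powr (1 - s) * T" .
      have "(\<Sum>x\<in>Xk k. real (card (fib l x)) powr s)
          \<le> (\<Sum>x\<in>Xk k. real (card (fib l x)) * (2 powr \<bar>s - 1\<bar> * (2 ^ k) powr (s - 1)))"
      proof (intro sum_mono powr_le_dyadic)
        fix x assume "x \<in> Xk k"
        then have "2 ^ k \<le> card (fib l x)" "card (fib l x) \<le> 2 * 2 ^ k" by (auto simp: Xk_def)
        then have "real (2 ^ k) \<le> real (card (fib l x))" "real (card (fib l x)) \<le> real (2 * 2 ^ k)"
          by (simp_all only: of_nat_le_iff)
        then show "2 ^ k \<le> real (card (fib l x))" "real (card (fib l x)) \<le> 2 * 2 ^ k" by simp_all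
      qed
      \<comment> \<open>The weight (2^k)^(s-1) is cancelled by the factor M^(1-q/r) of the
        hypothesis, so the bound does not depend on \<open>k\<close>.\<close>
      also have "\<dots> = real (card Z) * (2 powr \<bar>s - 1\<bar> * (2 ^ k) powr (s - 1))"
        unfolding Z_def using X finfib by (subst card_SigmaI) (auto simp: Xk_def sum_distrib_right)
      also have "\<dots> \<le> (\<bar>C0\<bar> * (2 ^ k) powr (1 - s) * T) * (2 powr \<bar>s - 1\<bar> * (2 ^ k) powr (s - 1))"
        using Zle by (intro mult_right_mono) auto
      also have "\<dots> = \<bar>C0\<bar> * 2 powr \<bar>s - 1\<bar> * T * ((2 ^ k) powr (1 - s) * (2 ^ k) powr (s - 1))"
        by (simp add: mult_ac)
      also have "(2 ^ k) powr (1 - s) * (2 ^ k) powr (s - 1) = (1::real)"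
        by (subst powr_add[symmetric]) simp
      finally show ?thesis by simp
    qed
    \<comment> \<open>Only an inequality: the dyadic ranges share endpoints, so a point may be
      counted twice. Empty fibres lie in no range and contribute
      \<open>0 powr s = 0\<close>.\<close>
    have "(\<Sum>x\<in>X. real (card (fib l x)) powr s)
        \<le> (\<Sum>x\<in>X. \<Sum>k\<le>K. if x \<in> Xk k then real (card (fib l x)) powr s else 0)"
    proof (rule sum_mono)
      fix x assume x: "x \<in> X"
      let ?b = "\<lambda>k. if x \<in> Xk k then real (card (fib l x)) powr s else 0"
      show "real (card (fib l x)) powr s \<le> (\<Sum>k\<le>K. ?b k)"
      proof (cases "card (fib l x) = 0")
        case True
        then show ?thesis by (auto intro!: sum_nonneg)
      next
        case False
        have "card (fib l x) \<le> card Y"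
          unfolding fib_def using Y by (intro card_mono) auto
        then obtain k where k: "k \<le> K" "2 ^ k \<le> card (fib l x)" "card (fib l x) \<le> 2 * 2 ^ k"
          using ex_dyadic_nat[of "card (fib l x)" K] K False by auto
        then have "?b k = real (card (fib l x)) powr s" using x by (simp add: Xk_def)
        moreover have "?b k \<le> (\<Sum>k\<le>K. ?b k)"
          using k by (intro member_le_sum) auto
        ultimately show ?thesis by simp
      qed
    qed
    also have "\<dots> = (\<Sum>k\<le>K. \<Sum>x\<in>X. if x \<in> Xk k then real (card (fib l x)) powr s else 0)"
      by (rule sum.swap)
    also have "\<dots> = (\<Sum>k\<le>K. \<Sum>x\<in>Xk k. real (card (fib l x)) powr s)"
    proof (rule sum.cong[OF refl])
      fix k
      have "X \<inter> Xk k = Xk k" by (auto simp: Xk_def)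
      then show "(\<Sum>x\<in>X. if x \<in> Xk k then real (card (fib l x)) powr s else 0)
          = (\<Sum>x\<in>Xk k. real (card (fib l x)) powr s)"
        using sum.inter_restrict[OF X(1), of "\<lambda>x. real (card (fib l x)) powr s" "Xk k"] by simp
    qed
    also have "\<dots> \<le> (\<Sum>k\<le>K. \<bar>C0\<bar> * 2 powr \<bar>s - 1\<bar> * T)"
      by (intro sum_mono dyadic)
    also have "\<dots> = \<bar>C0\<bar> * 2 powr \<bar>s - 1\<bar> * real (K + 1) * T" by simp
    finally have "(\<Prod>j=1..m. l j powr (p j * q)) * (\<Sum>x\<in>X. real (card (fib l x)) powr s)
        \<le> (\<Prod>j=1..m. l j powr (p j * q)) * (\<bar>C0\<bar> * 2 powr \<bar>s - 1\<bar> * real (K + 1) * T)"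
      by (intro mult_left_mono) (auto intro: prod_nonneg)
    also have "\<dots> = \<bar>C0\<bar> * 2 powr \<bar>s - 1\<bar> * real (K + 1) * ((\<Prod>j=1..m. l j powr (p j * q)) * T)"
      by (simp add: mult_ac)
    also have "(\<Prod>j=1..m. l j powr (p j * q)) * T \<le> R"
      unfolding T_def R_def prod.distrib[symmetric]
    proof (intro prod_mono conjI)
      fix j assume j: "j \<in> {1..m}"
      \<comment> \<open>Chebyshev's inequality for the level set \<open>S j\<close>.\<close>
      have "l j * real (card (S j)) = (\<Sum>z\<in>S j. F j z)" by (simp add: S_def)
      also have "\<dots> \<le> (\<Sum>z\<in>N j. F j z)"
        using N[OF j] F by (intro sum_mono2) (auto simp: S_def)
      finally have "(l j * real (card (S j))) powr (p j * q) \<le> (\<Sum>z\<in>N j. F j z) powr (p j * q)"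
        using l0[OF j] p[OF j] q by (intro powr_mono2) auto
      then show "l j powr (p j * q) * real (card (S j)) powr (p j * q)
          \<le> (\<Sum>z\<in>N j. F j z) powr (p j * q)"
        using l0[OF j] by (simp add: powr_mult)
    qed simp
    finally show ?thesis by (simp add: mult_left_mono)
  qed
  have "(\<Sum>x\<in>X. (\<Sum>y\<in>Y. \<Prod>j=1..m. F j (B j x y) powr (p j * r)) powr s)
      \<le> (\<Sum>x\<in>X. real (L ^ m) powr s *
          (\<Sum>l\<in>\<Lambda>. (\<Prod>j=1..m. l j powr (p j * q)) * real (card (fib l x)) powr s))"
  proof (rule sum_mono)
    fix x assume x: "x \<in> X"
    have "(\<Sum>y\<in>Y. \<Prod>j=1..m. F j (B j x y) powr (p j * r)) powr s
        \<le> real (card \<Lambda>) powr s * (\<Sum>l\<in>\<Lambda>. (real (card (fib l x)) * (\<Prod>j=1..m. l j powr (p j * r))) powr s)"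
      unfolding inner[OF x] using fin\<Lambda> s
      by (intro powr_sum_le_card_powr_sum) (auto intro!: mult_nonneg_nonneg prod_nonneg)
    \<comment> \<open>The exponents combine as (p_j r)(q/r) = p_j q, the weights that
      \<open>level\<close> expects.\<close>
    also have "\<dots> = real (card \<Lambda>) powr s *
        (\<Sum>l\<in>\<Lambda>. (\<Prod>j=1..m. l j powr (p j * q)) * real (card (fib l x)) powr s)"
      using r by (simp add: powr_mult prod_nonneg prod_powr_distrib powr_powr s_def mult_ac)
    also have "\<dots> \<le> real (L ^ m) powr s *
        (\<Sum>l\<in>\<Lambda>. (\<Prod>j=1..m. l j powr (p j * q)) * real (card (fib l x)) powr s)"
      using card\<Lambda> s by (intro mult_right_mono powr_mono2)
        (auto intro!: sum_nonneg mult_nonneg_nonneg prod_nonneg simp flip: of_nat_power)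
    finally show "(\<Sum>y\<in>Y. \<Prod>j=1..m. F j (B j x y) powr (p j * r)) powr s
        \<le> real (L ^ m) powr s *
        (\<Sum>l\<in>\<Lambda>. (\<Prod>j=1..m. l j powr (p j * q)) * real (card (fib l x)) powr s)" .
  qed
  also have "\<dots> = real (L ^ m) powr s *
      (\<Sum>l\<in>\<Lambda>. (\<Prod>j=1..m. l j powr (p j * q)) * (\<Sum>x\<in>X. real (card (fib l x)) powr s))"
    unfolding sum_distrib_left by (rule sum.swap)
  also have "\<dots> \<le> real (L ^ m) powr s *
      (\<Sum>l\<in>\<Lambda>. \<bar>C0\<bar> * 2 powr \<bar>s - 1\<bar> * real (K + 1) * R)"
    by (intro mult_left_mono sum_mono level) auto
  also have "\<dots> = real (L ^ m) powr s * (real (card \<Lambda>) * (\<bar>C0\<bar> * 2 powr \<bar>s - 1\<bar> * real (K + 1) * R))"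
    by simp
  also have "\<dots> \<le> real (L ^ m) powr s * (real (L ^ m) * (\<bar>C0\<bar> * 2 powr \<bar>s - 1\<bar> * real (K + 1) * R))"
    using card\<Lambda> R0 by (intro mult_left_mono mult_right_mono) (auto simp flip: of_nat_power)
  also have "\<dots> = \<bar>C0\<bar> * 2 powr \<bar>s - 1\<bar> * real (K + 1) * real (L ^ m) powr (s + 1) * R"
    by (simp add: powr_add mult_ac)
  finally show ?thesis unfolding B_def s_def R_def .
qed

section \<open>Powers of the integers\<close>

text \<open>An isomorphism is injective on the carrier, so passing to the images of
  \<open>S j\<close> and \<open>Z\<close> preserves every cardinality involved, including those of
  the fibres.\<close>

lemma restricted_weak_type_iso:
  fixes H :: "'h monoid" and G :: "'g monoid"
  assumes H: "group H" and G: "group G" and e: "e \<in> iso H G"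
    and rwt: "restricted_weak_type G m p q r P Q C0"
  shows "restricted_weak_type H m p q r P Q C0"
  unfolding restricted_weak_type_def
proof (intro allI impI)
  fix S :: "nat \<Rightarrow> 'h set" and M :: real and Z :: "('h \<times> 'h) set"
  assume S: "\<forall>j\<in>{1..m}. finite (S j) \<and> S j \<subseteq> carrier H" and M: "1 \<le> M"
    and Z: "finite Z" "Z \<subseteq> carrier H \<times> carrier H"
    and ZS: "\<forall>(z1, z2)\<in>Z. \<forall>j\<in>{1..m}. z1 [^]\<^bsub>H\<^esub> P j \<otimes>\<^bsub>H\<^esub> z2 [^]\<^bsub>H\<^esub> Q j \<in> S j"
    and ZM: "\<forall>g\<in>carrier H. card {z\<in>Z. fst z = g} = 0 \<or>
      M \<le> real (card {z\<in>Z. fst z = g}) \<and> real (card {z\<in>Z. fst z = g}) \<le> 2 * M"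
  have hom: "e \<in> hom H G" and bij: "bij_betw e (carrier H) (carrier G)"
    using e by (auto simp: iso_def)
  have inj: "inj_on e (carrier H)" and img: "e ` carrier H = carrier G"
    using bij by (auto simp: bij_betw_def)
  have inj2: "inj_on (map_prod e e) Z"
    using Z(2) by (intro inj_on_subset[OF map_prod_inj_on[OF inj inj]]) auto
  have pow: "e (x [^]\<^bsub>H\<^esub> a \<otimes>\<^bsub>H\<^esub> y [^]\<^bsub>H\<^esub> b) = e x [^]\<^bsub>G\<^esub> a \<otimes>\<^bsub>G\<^esub> e y [^]\<^bsub>G\<^esub> b"
    if "x \<in> carrier H" "y \<in> carrier H" for x y and a b :: int
    using that H G hom by (simp add: hom_mult[OF hom] hom_int_pow[OF hom] group.int_pow_closed)
  have fibre: "card {z \<in> map_prod e e ` Z. fst z = e h} = card {z\<in>Z. fst z = h}"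
    if h: "h \<in> carrier H" for h
  proof -
    have "{z \<in> map_prod e e ` Z. fst z = e h} = map_prod e e ` {z\<in>Z. fst z = h}"
    proof (intro equalityI subsetI)
      fix w assume "w \<in> {z \<in> map_prod e e ` Z. fst z = e h}"
      then obtain x y where xy: "(x, y) \<in> Z" "w = map_prod e e (x, y)" "e x = e h" by auto
      then have "x = h" using inj Z(2) h by (auto dest: inj_onD)
      with xy show "w \<in> map_prod e e ` {z\<in>Z. fst z = h}" by (intro image_eqI[of _ _ "(x, y)"]) auto
    qed auto
    then show ?thesis
      using inj2 by (simp add: card_image inj_on_def)
  qed
  have "real (card (map_prod e e ` Z))
      \<le> C0 * M powr (1 - q / r) * (\<Prod>j=1..m. real (card (e ` S j)) powr (p j * q))"
  proof (rule rwt[unfolded restricted_weak_type_def, rule_format])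
    fix j assume "j \<in> {1..m}"
    then show "finite (e ` S j) \<and> e ` S j \<subseteq> carrier G" using S img by blast
  next
    show "map_prod e e ` Z \<subseteq> carrier G \<times> carrier G" using Z(2) img by auto
  next
    fix z j assume "z \<in> map_prod e e ` Z"
    then obtain x y where "(x, y) \<in> Z" "z = (e x, e y)" by auto
    with ZS Z(2) pow[symmetric]
    show "case z of (z1, z2) \<Rightarrow> \<forall>j\<in>{1..m}. z1 [^]\<^bsub>G\<^esub> P j \<otimes>\<^bsub>G\<^esub> z2 [^]\<^bsub>G\<^esub> Q j \<in> e ` S j"
      by fastforce
  next
    fix g assume "g \<in> carrier G"
    then obtain h where "h \<in> carrier H" "g = e h" using img by auto
    then show "card {z \<in> map_prod e e ` Z. fst z = g} = 0 \<or>
        M \<le> real (card {z \<in> map_prod e e ` Z. fst z = g}) \<and>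
        real (card {z \<in> map_prod e e ` Z. fst z = g}) \<le> 2 * M"
      using ZM fibre by auto
  qed (use M Z in auto)
  also have "card (map_prod e e ` Z) = card Z"
    using inj2 by (rule card_image)
  also have "(\<Prod>j=1..m. real (card (e ` S j)) powr (p j * q)) = (\<Prod>j=1..m. real (card (S j)) powr (p j * q))"
    using S inj by (intro prod.cong refl) (metis card_image inj_on_subset)
  finally show "real (card Z) \<le> C0 * M powr (1 - q / r) * (\<Prod>j=1..m. real (card (S j)) powr (p j * q))" .
qed

text \<open>The hypothesis speaks only of groups carried by subsets of \<open>'g\<close>, while Z^n
  consists of functions. Its carrier is enumerated by naturals, these embed into the infinite type
  \<open>'g\<close>, and the group law is transported along the composite.\<close>

lemma ex_iso_countable_group:
  fixes H :: "'h monoid"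
  assumes H: "comm_group H" and count: "countable (carrier H)"
  obtains G :: "'g::infinite monoid" and e where "comm_group G" "e \<in> iso H G"
proof -
  interpret H: comm_group H by fact
  obtain g :: "nat \<Rightarrow> 'g" where g: "inj g"
    using infinite_countable_subset[OF infinite_UNIV] by blast
  define e where "e = g \<circ> to_nat_on (carrier H)"
  define d where "d = inv_into (carrier H) e"
  have inj: "inj_on e (carrier H)"
    unfolding e_def using g count by (intro comp_inj_on) (auto intro: inj_on_subset)
  then have d [simp]: "d (e x) = x" if "x \<in> carrier H" for x
    using that by (simp add: d_def)
  define G where "G = \<lparr>carrier = e ` carrier H,
    monoid.mult = (\<lambda>x y. e (d x \<otimes>\<^bsub>H\<^esub> d y)), one = e \<one>\<^bsub>H\<^esub>\<rparr>"
  have "comm_group G"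
    by (rule comm_groupI) (auto simp: G_def H.m_ac intro!: bexI[of _ "inv\<^bsub>H\<^esub> _"])
  moreover have "e \<in> iso H G"
    unfolding iso_def hom_def bij_betw_def using inj by (auto simp: G_def)
  ultimately show ?thesis by (rule that)
qed

lemma torsion_free_abelian_iso:
  assumes H: "torsion_free_abelian H" and G: "comm_group G" and e: "e \<in> iso H G"
  shows "torsion_free_abelian G"
  unfolding torsion_free_abelian_def
proof (intro conjI ballI allI impI G)
  interpret H: comm_group H using H by (simp add: torsion_free_abelian_def)
  interpret G: comm_group G by fact
  have hom: "e \<in> hom H G" and bij: "bij_betw e (carrier H) (carrier G)"
    using e by (auto simp: iso_def)
  fix x and n :: nat assume x: "x \<in> carrier G" and n: "n > 0" and xn: "x [^]\<^bsub>G\<^esub> n = \<one>\<^bsub>G\<^esub>"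
  obtain h where h: "h \<in> carrier H" "x = e h" using x bij by (auto simp: bij_betw_def)
  have one: "e \<one>\<^bsub>H\<^esub> = \<one>\<^bsub>G\<^esub>"
    using hom by (simp add: hom_one H.is_group G.is_group)
  have "e (h [^]\<^bsub>H\<^esub> n) = e \<one>\<^bsub>H\<^esub>"
    using hom_nat_pow[OF hom h(1) H.is_group G.is_group, of n] xn h one by simp
  then have "h [^]\<^bsub>H\<^esub> n = \<one>\<^bsub>H\<^esub>"
    using bij h by (auto simp: bij_betw_def inj_on_def)
  then have "h = \<one>\<^bsub>H\<^esub>" using H h n by (auto simp: torsion_free_abelian_def)
  then show "x = \<one>\<^bsub>G\<^esub>" using h one by simp
qed

lemma restricted_weak_type_countable:
  fixes H :: "'h monoid"
  assumes rwt: "\<And>G :: 'g::infinite monoid. torsion_free_abelian G \<Longrightarrow> restricted_weak_type G m p q r P Q C0"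
    and H: "torsion_free_abelian H" and count: "countable (carrier H)"
  shows "restricted_weak_type H m p q r P Q C0"
proof -
  have HG: "comm_group H" using H by (simp add: torsion_free_abelian_def)
  obtain G :: "'g monoid" and e where G: "comm_group G" "e \<in> iso H G"
    using ex_iso_countable_group[OF HG count] .
  show ?thesis
    using restricted_weak_type_iso[OF _ _ G(2) rwt[OF torsion_free_abelian_iso[OF H G]]]
      HG G(1) by (simp add: comm_group.axioms(2))
qed

section \<open>Coordinatewise powers and the group Z^n\<close>

lemma nat_pow_product_group:
  assumes "x \<in> carrier (product_group I G)"
  shows "x [^]\<^bsub>product_group I G\<^esub> (k::nat) = (\<lambda>i\<in>I. x i [^]\<^bsub>G i\<^esub> k)"
proof (induction k)
  case (Suc k)
  show ?case
    unfolding nat_pow_Suc Suc mult_product_group by (intro restrict_ext) simp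
qed simp

lemma int_pow_product_group:
  assumes G: "\<And>i. i \<in> I \<Longrightarrow> group (G i)" and x: "x \<in> carrier (product_group I G)"
  shows "x [^]\<^bsub>product_group I G\<^esub> (k::int) = (\<lambda>i\<in>I. x i [^]\<^bsub>G i\<^esub> k)"
proof -
  have xi: "x i \<in> carrier (G i)" if "i \<in> I" for i using x that by auto
  have mem: "(\<lambda>i\<in>I. x i [^]\<^bsub>G i\<^esub> nat (- k)) \<in> (\<Pi>\<^sub>E i\<in>I. carrier (G i))"
    using xi G by (auto simp: group.is_monoid monoid.nat_pow_closed)
  show ?thesis
  proof (cases "k < 0")
    case True
    have "x [^]\<^bsub>product_group I G\<^esub> k
        = inv\<^bsub>product_group I G\<^esub> (\<lambda>i\<in>I. x i [^]\<^bsub>G i\<^esub> nat (- k))"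
      by (simp only: int_pow_def2 True if_True nat_pow_product_group[OF x])
    also have "\<dots> = (\<lambda>i\<in>I. inv\<^bsub>G i\<^esub> ((\<lambda>i\<in>I. x i [^]\<^bsub>G i\<^esub> nat (- k)) i))"
      using mem G by (rule inv_product_group)
    also have "\<dots> = (\<lambda>i\<in>I. x i [^]\<^bsub>G i\<^esub> k)"
      by (intro restrict_ext) (simp only: int_pow_def2 True if_True restrict_apply')
    finally show ?thesis .
  next
    case False
    then show ?thesis
      by (simp only: int_pow_def2 if_False nat_pow_product_group[OF x])
  qed
qed

text \<open>All \<open>n\<close> share one type, and tuples are \<open>undefined\<close> outside
  \<open>{..<n}\<close>. The carrier is thus an extensional product, over which sums of tensor
  products factor.\<close>

definition int_power_group :: "nat \<Rightarrow> (nat \<Rightarrow> int) monoid" where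
  "int_power_group n = product_group {..<n} (\<lambda>_. integer_group)"

lemma carrier_int_power_group: "carrier (int_power_group n) = {..<n} \<rightarrow>\<^sub>E UNIV"
  by (simp add: int_power_group_def)

lemma torsion_free_abelian_int_power_group: "torsion_free_abelian (int_power_group n)"
  unfolding torsion_free_abelian_def
proof (intro conjI ballI allI impI)
  show "comm_group (int_power_group n)"
    unfolding int_power_group_def
    by (rule group.group_comm_groupI) (auto simp: add.commute intro!: restrict_ext)
  fix x and k :: nat
  assume x: "x \<in> carrier (int_power_group n)" and k: "0 < k"
    and eq: "x [^]\<^bsub>int_power_group n\<^esub> k = \<one>\<^bsub>int_power_group n\<^esub>"
  have "(\<lambda>i\<in>{..<n}. int k * x i) = (\<lambda>i\<in>{..<n}. 0)"
    using eq nat_pow_product_group[of x "{..<n}" "\<lambda>_. integer_group" k] x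
    by (simp add: int_power_group_def)
  then have "int k * x i = 0" if "i < n" for i
    using that by (auto dest: fun_cong[of _ _ i])
  then show "x = \<one>\<^bsub>int_power_group n\<^esub>"
    using k x by (auto simp: int_power_group_def fun_eq_iff PiE_iff extensional_def)
qed

lemma int_power_group_lincomb:
  assumes "x \<in> carrier (int_power_group n)" "y \<in> carrier (int_power_group n)"
  shows "x [^]\<^bsub>int_power_group n\<^esub> a \<otimes>\<^bsub>int_power_group n\<^esub> y [^]\<^bsub>int_power_group n\<^esub> b
    = (\<lambda>i\<in>{..<n}. (a::int) * x i + b * y i)"
proof -
  have x: "x \<in> carrier (product_group {..<n} (\<lambda>_. integer_group))"
    and y: "y \<in> carrier (product_group {..<n} (\<lambda>_. integer_group))"
    using assms unfolding int_power_group_def by blast+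
  show ?thesis
    unfolding int_power_group_def mult_product_group
      int_pow_product_group[OF group_integer_group x] int_pow_product_group[OF group_integer_group y]
    by (intro restrict_ext) simp
qed

text \<open>A value of the tensor power only depends on how often each \<open>v \<in> N\<close> occurs among the
  coordinates.\<close>

lemma card_tensor_power_values:
  fixes f :: "'a \<Rightarrow> real"
  assumes N: "finite N"
  shows "card ((\<lambda>z. \<Prod>i<n. f (z i)) ` ({..<n} \<rightarrow>\<^sub>E N)) \<le> (n + 1) ^ card N"
proof -
  let ?h = "\<lambda>t. \<Prod>v\<in>N. f v ^ t v"
  have "(\<lambda>z. \<Prod>i<n. f (z i)) ` ({..<n} \<rightarrow>\<^sub>E N) \<subseteq> ?h ` (N \<rightarrow>\<^sub>E {..n})"
  proof (rule image_subsetI)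
    fix z assume z: "z \<in> {..<n} \<rightarrow>\<^sub>E N"
    define t where "t = (\<lambda>v\<in>N. card {i\<in>{..<n}. z i = v})"
    have "(\<Prod>i<n. f (z i)) = (\<Prod>v\<in>N. \<Prod>i\<in>{i\<in>{..<n}. z i = v}. f (z i))"
      by (rule prod.group[symmetric]) (use N z in auto)
    also have "\<dots> = ?h t"
      unfolding t_def by (intro prod.cong refl) (simp add: prod.cong)
    finally have "(\<Prod>i<n. f (z i)) = ?h t" .
    moreover have "t \<in> N \<rightarrow>\<^sub>E {..n}"
    proof (rule PiE_I)
      fix v assume "v \<in> N"
      then show "t v \<in> {..n}"
        using card_mono[of "{..<n}" "{i\<in>{..<n}. z i = v}"] by (auto simp: t_def)
    qed (simp add: t_def)
    ultimately show "(\<Prod>i<n. f (z i)) \<in> ?h ` (N \<rightarrow>\<^sub>E {..n})" by blast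
  qed
  moreover have fin: "finite (N \<rightarrow>\<^sub>E {..n})" using N by (intro finite_PiE) auto
  ultimately have "card ((\<lambda>z. \<Prod>i<n. f (z i)) ` ({..<n} \<rightarrow>\<^sub>E N)) \<le> card (?h ` (N \<rightarrow>\<^sub>E {..n}))"
    by (intro card_mono) auto
  also have "\<dots> \<le> card (N \<rightarrow>\<^sub>E {..n})" using fin by (rule card_image_le)
  also have "\<dots> = (n + 1) ^ card N" using N by (simp add: card_PiE)
  finally show ?thesis .
qed

text \<open>If \<open>a > b > 0\<close>, then (a/b)^n outgrows any polynomial. This is how the n-th
  root is taken.\<close>

lemma le_of_power_le_poly_mult_power:
  fixes a b c d :: real
  assumes a: "a \<ge> 0" and b: "b \<ge> 0"
    and le: "\<And>n. n > 0 \<Longrightarrow> a ^ n \<le> c * real (n + 1) powr d * b ^ n"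
  shows "a \<le> b"
proof (rule ccontr)
  assume "\<not> a \<le> b"
  then have ab: "a > b" by simp
  \<comment> \<open>With \<open>b = 0\<close> the case n = 1 would give
    \<open>a <= 0\<close>.\<close>
  have "b \<noteq> 0" using le[of 1] ab by auto
  then have b: "b > 0" using b by simp
  define t where "t = a / b"
  have t: "t > 1" using ab b by (simp add: t_def)
  have "((\<lambda>n. c * real (n + 1) powr d / t ^ n) \<longlongrightarrow> 0) sequentially"
    using t by real_asymp
  then have "eventually (\<lambda>n. c * real (n + 1) powr d / t ^ n < 1) sequentially"
    by (rule order_tendstoD) simp
  then obtain k where "\<And>n. n \<ge> k \<Longrightarrow> c * real (n + 1) powr d / t ^ n < 1"
    by (auto simp: eventually_sequentially)
  then obtain n :: nat where n: "n > 0" "c * real (n + 1) powr d / t ^ n < 1"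
    using le_SucI[OF order_refl, of k] by blast
  have "c * real (n + 1) powr d < t ^ n"
    using n t by (simp add: divide_simps)
  then have "c * real (n + 1) powr d * b ^ n < a ^ n"
    using b by (simp add: t_def power_divide divide_simps)
  with le[OF n(1)] show False by simp
qed

section \<open>The tensor power trick\<close>

lemma sum_tensor_power:
  fixes g :: "'a \<Rightarrow> 'b :: comm_semiring_1"
  assumes "finite X"
  shows "(\<Sum>x\<in>{..<n} \<rightarrow>\<^sub>E X. \<Prod>i<n. g (x i)) = (\<Sum>x\<in>X. g x) ^ n"
  using prod_sum_PiE[of "{..<n}" "\<lambda>_. X" "\<lambda>_. g"] assms by simp

text \<open>For the tensor powers \<open>F j\<close> on Z^n both sides of the lossy inequality are
  n-th powers of the two sides here, while the loss is at most
  \<open>c * real (n + 1) powr d\<close> with \<open>c\<close> and \<open>d\<close> independent of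
  n.\<close>

lemma discrete_strong_type:
  fixes f :: "nat \<Rightarrow> int \<Rightarrow> real"
  assumes rwt: "\<And>n. restricted_weak_type (int_power_group n) m p q r P Q C0"
    and q: "q > 0" and r: "r > 0" and p: "\<And>j. j \<in> {1..m} \<Longrightarrow> p j > 0"
    and X: "finite X" and Y: "finite Y" and N: "\<And>j. j \<in> {1..m} \<Longrightarrow> finite (N j)"
    and maps: "\<And>x y j. x \<in> X \<Longrightarrow> y \<in> Y \<Longrightarrow> j \<in> {1..m} \<Longrightarrow> P j * x + Q j * y \<in> N j"
    and f: "\<And>j n. f j n \<ge> 0"
  shows "(\<Sum>x\<in>X. (\<Sum>y\<in>Y. \<Prod>j=1..m. f j (P j * x + Q j * y) powr (p j * r)) powr (q / r))
    \<le> (\<Prod>j=1..m. (\<Sum>n\<in>N j. f j n) powr (p j * q))" (is "?A \<le> ?B")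
proof -
  define s where "s = q / r"
  define g where "g x = (\<Sum>y\<in>Y. \<Prod>j=1..m. f j (P j * x + Q j * y) powr (p j * r))" for x
  \<comment> \<open>A common upper bound for all \<open>card (N j)\<close>, so that one
    \<open>L\<close> serves every \<open>j\<close>.\<close>
  define D where "D = (\<Sum>j=1..m. card (N j))"
  define c where "c = \<bar>C0\<bar> * 2 powr \<bar>s - 1\<bar> * real (card Y + 1)"
  \<comment> \<open>The first summand comes from the \<open>L ^ m\<close> level tuples to the power
    s + 1, the last 1 from the dyadic ranges, whose number is linear in n.\<close>
  define d where "d = real (D * m) * (s + 1) + 1"
  show ?thesis
  proof (rule le_of_power_le_poly_mult_power)
    show "?A \<ge> 0" by (intro sum_nonneg) auto
    show "?B \<ge> 0" by (intro prod_nonneg) auto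
    fix n :: nat assume n: "n > 0"
    let ?G = "int_power_group n"
    define F where "F j z = (\<Prod>i<n. f j (z i))" for j and z :: "nat \<Rightarrow> int"
    define Xn where "Xn = ({..<n} \<rightarrow>\<^sub>E X)"
    define Yn where "Yn = ({..<n} \<rightarrow>\<^sub>E Y)"
    define Nn where "Nn j = ({..<n} \<rightarrow>\<^sub>E N j)" for j
    \<comment> \<open>Chosen by |Y|^n <= (2^|Y|)^n.\<close>
    define K where "K = card Y * n"
    define L where "L = (n + 1) ^ D"
    have sub: "Xn \<subseteq> carrier ?G" "Yn \<subseteq> carrier ?G" "Nn j \<subseteq> carrier ?G" for j
      unfolding Xn_def Yn_def Nn_def carrier_int_power_group by auto
    have lin: "x [^]\<^bsub>?G\<^esub> P j \<otimes>\<^bsub>?G\<^esub> y [^]\<^bsub>?G\<^esub> Q j = (\<lambda>i\<in>{..<n}. P j * x i + Q j * y i)"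
      if "x \<in> Xn" "y \<in> Yn" for x y j
      using that sub by (intro int_power_group_lincomb) auto
    have lossy: "(\<Sum>x\<in>Xn. (\<Sum>y\<in>Yn. \<Prod>j=1..m.
            F j (x [^]\<^bsub>?G\<^esub> P j \<otimes>\<^bsub>?G\<^esub> y [^]\<^bsub>?G\<^esub> Q j) powr (p j * r)) powr (q / r))
        \<le> \<bar>C0\<bar> * 2 powr \<bar>q / r - 1\<bar> * real (K + 1) * real (L ^ m) powr (q / r + 1)
         * (\<Prod>j=1..m. (\<Sum>z\<in>Nn j. F j z) powr (p j * q))"
    proof (rule restricted_weak_type_imp_lossy_strong_type[OF rwt q r])
      show "finite Xn" "finite Yn" unfolding Xn_def Yn_def using X Y by (auto intro: finite_PiE)
      show "F j z \<ge> 0" for j z unfolding F_def using f by (intro prod_nonneg) auto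
      have "card Yn = card Y ^ n" unfolding Yn_def using Y by (simp add: card_PiE)
      also have "\<dots> \<le> (2 ^ card Y) ^ n" by (intro power_mono) (auto intro: less_imp_le less_exp)
      finally show "card Yn \<le> 2 ^ K" by (simp add: K_def power_mult)
    next
      fix j assume j: "j \<in> {1..m}"
      show "finite (Nn j)" unfolding Nn_def using N[OF j] by (auto intro: finite_PiE)
      have "card (F j ` Nn j) \<le> (n + 1) ^ card (N j)"
        unfolding F_def Nn_def using N[OF j] by (rule card_tensor_power_values)
      also have "card (N j) \<le> D" unfolding D_def using j by (intro member_le_sum) auto
      then have "(n + 1) ^ card (N j) \<le> L" unfolding L_def by (intro power_increasing) auto
      finally show "card (F j ` Nn j) \<le> L" .
    next
      fix x y j assume xy: "x \<in> Xn" "y \<in> Yn" and j: "j \<in> {1..m}"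
      show "x [^]\<^bsub>?G\<^esub> P j \<otimes>\<^bsub>?G\<^esub> y [^]\<^bsub>?G\<^esub> Q j \<in> Nn j"
        unfolding lin[OF xy] using xy unfolding Xn_def Yn_def Nn_def
        by (auto intro!: maps[OF _ _ j])
    qed (use sub p in auto)
    have "?A ^ n = (\<Sum>x\<in>Xn. \<Prod>i<n. g (x i) powr s)"
      unfolding Xn_def g_def[symmetric] s_def[symmetric] using X by (rule sum_tensor_power[symmetric])
    also have "\<dots> = (\<Sum>x\<in>Xn. (\<Sum>y\<in>Yn. \<Prod>j=1..m.
            F j (x [^]\<^bsub>?G\<^esub> P j \<otimes>\<^bsub>?G\<^esub> y [^]\<^bsub>?G\<^esub> Q j) powr (p j * r)) powr (q / r))"
    proof (rule sum.cong[OF refl])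
      fix x assume x: "x \<in> Xn"
      have "(\<Prod>i<n. g (x i) powr s) = (\<Prod>i<n. g (x i)) powr s"
        by (rule prod_powr_distrib[symmetric])
      also have "(\<Prod>i<n. g (x i))
          = (\<Sum>y\<in>Yn. \<Prod>i<n. \<Prod>j=1..m. f j (P j * x i + Q j * y i) powr (p j * r))"
        unfolding Yn_def g_def using Y by (intro prod_sum_PiE) auto
      also have "\<dots> = (\<Sum>y\<in>Yn. \<Prod>j=1..m.
            F j (x [^]\<^bsub>?G\<^esub> P j \<otimes>\<^bsub>?G\<^esub> y [^]\<^bsub>?G\<^esub> Q j) powr (p j * r))"
      proof (rule sum.cong[OF refl])
        fix y assume y: "y \<in> Yn"
        have "(\<Prod>i<n. \<Prod>j=1..m. f j (P j * x i + Q j * y i) powr (p j * r))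
            = (\<Prod>j=1..m. \<Prod>i<n. f j (P j * x i + Q j * y i) powr (p j * r))"
          by (rule prod.swap)
        then show "(\<Prod>i<n. \<Prod>j=1..m. f j (P j * x i + Q j * y i) powr (p j * r))
            = (\<Prod>j=1..m. F j (x [^]\<^bsub>?G\<^esub> P j \<otimes>\<^bsub>?G\<^esub> y [^]\<^bsub>?G\<^esub> Q j) powr (p j * r))"
          unfolding lin[OF x y] F_def using f by (simp add: prod_powr_distrib)
      qed
      finally show "(\<Prod>i<n. g (x i) powr s) = (\<Sum>y\<in>Yn. \<Prod>j=1..m.
            F j (x [^]\<^bsub>?G\<^esub> P j \<otimes>\<^bsub>?G\<^esub> y [^]\<^bsub>?G\<^esub> Q j) powr (p j * r)) powr (q / r)"
        by (simp add: s_def)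
    qed
    also note lossy
    also have "(\<Prod>j=1..m. (\<Sum>z\<in>Nn j. F j z) powr (p j * q)) = ?B ^ n"
      unfolding prod_power_distrib Nn_def F_def
    proof (intro prod.cong refl)
      fix j assume j: "j \<in> {1..m}"
      have "(\<Sum>n\<in>N j. f j n) \<ge> 0" using f by (intro sum_nonneg) auto
      then show "(\<Sum>z\<in>{..<n} \<rightarrow>\<^sub>E N j. \<Prod>i<n. f j (z i)) powr (p j * q)
          = ((\<Sum>n\<in>N j. f j n) powr (p j * q)) ^ n"
        unfolding sum_tensor_power[OF N[OF j]]
        using prod_powr_distrib[where I = "{..<n}" and x = "\<lambda>_. \<Sum>n\<in>N j. f j n" and r = "p j * q"] by simp
    qed
    also have "\<bar>C0\<bar> * 2 powr \<bar>q / r - 1\<bar> * real (K + 1) * real (L ^ m) powr (q / r + 1)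
        \<le> c * real (n + 1) powr d"
    proof -
      have "real (L ^ m) powr (s + 1) = real (n + 1) powr (real (D * m) * (s + 1))"
        unfolding L_def by (simp add: power_mult[symmetric] powr_powr flip: powr_realpow)
      moreover have "K + 1 \<le> (card Y + 1) * (n + 1)" by (simp add: K_def)
      then have "real (K + 1) \<le> real (card Y + 1) * real (n + 1)"
        by (metis of_nat_le_iff of_nat_mult)
      ultimately have "real (K + 1) * real (L ^ m) powr (s + 1)
          \<le> real (card Y + 1) * real (n + 1) * real (n + 1) powr (real (D * m) * (s + 1))"
        by (simp add: mult_right_mono)
      also have "\<dots> = real (card Y + 1) * real (n + 1) powr d"
        by (simp add: d_def powr_add)
      finally show ?thesis
        unfolding c_def s_def[symmetric] by (simp add: mult.assoc mult_left_mono)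
    qed
    finally show "?A ^ n \<le> c * real (n + 1) powr d * ?B ^ n"
      by (simp add: mult_right_mono prod_nonneg)
  qed
qed

section \<open>From the integers to the real line\<close>

lemma ennpowr_ennreal: "x \<ge> 0 \<Longrightarrow> ennpowr (ennreal x) a = ennreal (x powr a)"
  by (simp add: ennpowr_def)

lemma ennpowr_mono:
  assumes "s \<le> t" "a > 0"
  shows "ennpowr s a \<le> ennpowr t a"
proof (cases t)
  case (real y)
  then obtain x where "x \<ge> 0" "s = ennreal x"
    using assms(1) by (metis ennreal_cases ennreal_neq_top neq_top_trans)
  then show ?thesis
    using real assms by (auto simp: ennpowr_ennreal intro!: ennreal_leI powr_mono2)
qed (simp add: ennpowr_def)

lemma ennpowr_ennpowr_inverse:
  assumes "a > 0"
  shows "ennpowr (ennpowr t (1 / a)) a = t"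
proof (cases t)
  case (real x)
  then show ?thesis using assms by (simp add: ennpowr_ennreal powr_powr)
qed (simp add: ennpowr_def)

text \<open>A monotone map with open range is continuous; the exponent \<open>1 / a\<close> supplies
  preimages, so the range is everything. No separate argument at infinity arises.\<close>

lemma continuous_on_ennpowr:
  assumes "a > 0"
  shows "continuous_on UNIV (\<lambda>t. ennpowr t a)"
proof (rule continuous_onI_mono)
  have "surj (\<lambda>t. ennpowr t a)"
    using ennpowr_ennpowr_inverse[OF assms] by (metis surjI)
  then show "open (range (\<lambda>t. ennpowr t a))" by simp
qed (use ennpowr_mono assms in auto)

text \<open>Lets the exponent q/r between the two integrals pass through the lower limit that
  Fatou's lemma produces in y.\<close>

lemma liminf_ennpowr:
  assumes "a > 0"
  shows "liminf (\<lambda>n. ennpowr (u n) a) = ennpowr (liminf u) a"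
  using continuous_on_ennpowr[OF assms]
  by (rule Liminf_compose_continuous_mono) (auto intro!: monoI ennpowr_mono assms)

text \<open>A cheap substitute for the Vitali--Caratheodory theorem: each dyadic level set of \<open>f\<close> is
  covered by an open set, at the price of the factor 2.\<close>

lemma lsc_majorant:
  fixes f :: "real \<Rightarrow> real"
  assumes f: "integrable lebesgue f" "\<And>t. f t \<ge> 0" and e: "e > 0"
  obtains G :: "real \<Rightarrow> ennreal" where "\<And>c. open {t. c < G t}" "\<And>t. ennreal (f t) \<le> G t"
    "(\<integral>\<^sup>+t. G t \<partial>lborel) \<le> ennreal (2 * (LINT t|lebesgue. f t) + e)"
proof -
  \<comment> \<open>\<open>int_decode\<close> lists all integers as a sequence, so that the
    two-sided family of dyadic levels can be summed by \<open>suminf\<close>.\<close>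
  define c :: "nat \<Rightarrow> real" where "c i = 2 powr real_of_int (int_decode i)" for i
  define A where "A i = {t. c i < f t \<and> f t \<le> 2 * c i}" for i
  \<comment> \<open>The excess of the i-th open set then costs 2 c_i delta_i = e 2^(-i-1), in total
    e.\<close>
  define \<delta> where "\<delta> i = e * (1 / 2) ^ Suc i / (2 * c i)" for i
  have c0: "c i > 0" for i by (simp add: c_def)
  have \<delta>0: "\<delta> i > 0" for i using e c0 by (simp add: \<delta>_def)
  have fm: "f \<in> borel_measurable lebesgue" using f(1) by (rule borel_measurable_integrable)
  have Am: "A i \<in> sets lebesgue" for i
  proof -
    have "A i = {t \<in> space lebesgue. c i < f t \<and> f t \<le> 2 * c i}" by (simp add: A_def)
    also have "\<dots> \<in> sets lebesgue" using fm by measurable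
    finally show ?thesis .
  qed
  have ind: "(\<lambda>t. ennreal (2 * c i) * indicator B t) \<in> borel_measurable lebesgue"
    if "B \<in> sets lebesgue" for B i
    using that by (intro borel_measurable_times_ennreal borel_measurable_const borel_measurable_indicator)
  have "\<exists>U. open U \<and> A i \<subseteq> U \<and> emeasure lebesgue (U - A i) < ennreal (\<delta> i)" for i
    using sets_lebesgue_outer_open[OF Am \<delta>0] by metis
  then obtain U where U: "\<And>i. open (U i)" "\<And>i. A i \<subseteq> U i"
      "\<And>i. emeasure lebesgue (U i - A i) < ennreal (\<delta> i)" by metis
  have Um: "U i \<in> sets lebesgue" for i using U(1) by auto
  define G where "G t = (SUP i. ennreal (2 * c i) * indicator (U i) t)" for t
  have disj: "disjoint_family A"
    unfolding disjoint_family_on_def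
  proof (intro ballI impI)
    fix i k :: nat assume "i \<noteq> k"
    then have ne: "int_decode i \<noteq> int_decode k" by (metis int_decode_inverse)
    have *: "A i \<inter> A k = {}" if "int_decode i < int_decode k" for i k
    proof -
      have "2 * c i = 2 powr (real_of_int (int_decode i) + 1)" by (simp add: c_def powr_add)
      also have "\<dots> \<le> c k" unfolding c_def using that by (intro powr_mono) auto
      finally show ?thesis by (auto simp: A_def)
    qed
    show "A i \<inter> A k = {}" using *[of i k] *[of k i] ne by (cases "int_decode i < int_decode k") auto
  qed
  have "open {t. b < G t}" for b
  proof -
    \<comment> \<open>A supremum of multiples of indicators of open sets has open superlevel
      sets.\<close>
    have "{t. b < G t} = (\<Union>i\<in>{i. b < ennreal (2 * c i)}. U i)"
      unfolding G_def less_SUP_iff by (auto simp: indicator_def split: if_splits)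
    then show ?thesis using U(1) by auto
  qed
  moreover have "ennreal (f t) \<le> G t" for t
  proof (cases "f t = 0")
    case False
    then have ft: "f t > 0" using f(2)[of t] by simp
    \<comment> \<open>The levels \<open>A i\<close> are open below and closed above, hence ceiling
      minus one and not the floor.\<close>
    define k where "k = \<lceil>log 2 (f t)\<rceil> - 1"
    define i where "i = int_encode k"
    have k: "real_of_int k < log 2 (f t)" "log 2 (f t) \<le> real_of_int k + 1"
      unfolding k_def by linarith+
    have "2 powr real_of_int k < f t" using k(1) ft by (simp add: less_log_iff)
    moreover have "f t \<le> 2 powr (real_of_int k + 1)" using k(2) ft by (simp add: log_le_iff)
    ultimately have "t \<in> A i" by (simp add: A_def c_def i_def powr_add)
    then have "ennreal (f t) \<le> ennreal (2 * c i) * indicator (U i) t"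
      using U(2)[of i] by (auto simp: A_def intro!: ennreal_leI)
    also have "\<dots> \<le> G t" unfolding G_def by (rule SUP_upper) simp
    finally show ?thesis .
  qed simp
  moreover have "(\<integral>\<^sup>+t. G t \<partial>lborel) \<le> ennreal (2 * (LINT t|lebesgue. f t) + e)"
  proof -
    have emU: "emeasure lebesgue (U i) \<le> emeasure lebesgue (A i) + ennreal (\<delta> i)" for i
    proof -
      have "emeasure lebesgue (U i) = emeasure lebesgue (A i \<union> (U i - A i))"
        using U(2)[of i] by (simp add: Un_absorb1)
      also have "\<dots> \<le> emeasure lebesgue (A i) + emeasure lebesgue (U i - A i)"
        using Am Um by (intro emeasure_subadditive) auto
      also have "\<dots> \<le> emeasure lebesgue (A i) + ennreal (\<delta> i)"
        using U(3)[of i] by (intro add_left_mono) auto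
      finally show ?thesis .
    qed
    have "(\<integral>\<^sup>+t. G t \<partial>lborel) = (\<integral>\<^sup>+t. G t \<partial>lebesgue)" by (simp add: nn_integral_completion)
    also have "\<dots> \<le> (\<integral>\<^sup>+t. (\<Sum>i. ennreal (2 * c i) * indicator (U i) t) \<partial>lebesgue)"
    proof (rule nn_integral_mono)
      fix t
      show "G t \<le> (\<Sum>i. ennreal (2 * c i) * indicator (U i) t)"
        unfolding G_def
      proof (rule SUP_least)
        fix i
        show "ennreal (2 * c i) * indicator (U i) t \<le> (\<Sum>i. ennreal (2 * c i) * indicator (U i) t)"
        proof -
          define h where "h k = ennreal (2 * c k) * indicator (U k) t" for k
          have "(\<Sum>k\<in>{i}. h k) \<le> (\<Sum>k. h k)" by (intro sum_le_suminf) auto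
          then have "h i \<le> (\<Sum>k. h k)" by simp
          then show ?thesis unfolding h_def .
        qed
      qed
    qed
    also have "\<dots> = (\<Sum>i. \<integral>\<^sup>+t. ennreal (2 * c i) * indicator (U i) t \<partial>lebesgue)"
      by (intro nn_integral_suminf ind Um)
    also have "\<dots> = (\<Sum>i. ennreal (2 * c i) * emeasure lebesgue (U i))"
      by (intro suminf_cong nn_integral_cmult_indicator Um)
    also have "\<dots> \<le> (\<Sum>i. ennreal (2 * c i) * emeasure lebesgue (A i) + ennreal (2 * c i) * ennreal (\<delta> i))"
      using emU by (intro suminf_le) (auto simp flip: distrib_left intro!: mult_left_mono)
    also have "\<dots> = (\<Sum>i. ennreal (2 * c i) * emeasure lebesgue (A i)) + (\<Sum>i. ennreal (2 * c i) * ennreal (\<delta> i))"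
      by (rule suminf_add[symmetric]) auto
    also have "(\<Sum>i. ennreal (2 * c i) * ennreal (\<delta> i)) = (\<Sum>i. ennreal (e * (1 / 2) ^ Suc i))"
    proof (rule suminf_cong)
      fix i
      have "ennreal (2 * c i) * ennreal (\<delta> i) = ennreal (2 * c i * \<delta> i)"
        using c0[of i] \<delta>0[of i] by (intro ennreal_mult[symmetric]) auto
      also have "2 * c i * \<delta> i = e * (1 / 2) ^ Suc i"
        using c0[of i] by (simp add: \<delta>_def)
      finally show "ennreal (2 * c i) * ennreal (\<delta> i) = ennreal (e * (1 / 2) ^ Suc i)" .
    qed
    also have "\<dots> = ennreal e"
    proof -
      have "(\<lambda>i. e * (1 / 2) ^ Suc i) sums (e * 1)"
        by (intro sums_mult power_half_series)
      then show ?thesis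
        using e by (subst suminf_ennreal_eq) auto
    qed
    also have "(\<Sum>i. ennreal (2 * c i) * emeasure lebesgue (A i))
        = (\<Sum>i. \<integral>\<^sup>+t. ennreal (2 * c i) * indicator (A i) t \<partial>lebesgue)"
      by (intro suminf_cong nn_integral_cmult_indicator[symmetric] Am)
    also have "\<dots> = (\<integral>\<^sup>+t. (\<Sum>i. ennreal (2 * c i) * indicator (A i) t) \<partial>lebesgue)"
      by (intro nn_integral_suminf[symmetric] ind Am)
    \<comment> \<open>At most one level contains \<open>t\<close>, and there
      \<open>c i < f t\<close>; off all levels the sum is 0.\<close>
    also have "\<dots> \<le> (\<integral>\<^sup>+t. ennreal (2 * f t) \<partial>lebesgue)"
    proof (rule nn_integral_mono)
      fix t
      show "(\<Sum>i. ennreal (2 * c i) * indicator (A i) t) \<le> ennreal (2 * f t)"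
      proof (cases "\<exists>i. t \<in> A i")
        case True
        then obtain i where i: "t \<in> A i" ..
        have "t \<notin> A k" if "k \<noteq> i" for k
          using disj i that unfolding disjoint_family_on_def by blast
        then have "(\<Sum>i. ennreal (2 * c i) * indicator (A i) t) = (\<Sum>i\<in>{i}. ennreal (2 * c i) * indicator (A i) t)"
          by (intro suminf_finite) auto
        also have "\<dots> \<le> ennreal (2 * f t)" using i by (auto simp: A_def intro!: ennreal_leI)
        finally show ?thesis .
      qed simp
    qed
    also have "\<dots> = ennreal (LINT t|lebesgue. 2 * f t)"
      using f by (intro nn_integral_eq_integral) auto
    finally have "(\<integral>\<^sup>+t. G t \<partial>lborel) \<le> ennreal (2 * (LINT t|lebesgue. f t)) + ennreal e"
      by (simp add: add_right_mono)
    also have "\<dots> = ennreal (2 * (LINT t|lebesgue. f t) + e)"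
      using e f(2) by (intro ennreal_plus[symmetric]) auto
    finally show ?thesis .
  qed
  ultimately show ?thesis by (rule that)
qed

section \<open>Step functions on the grid of mesh 1/N\<close>

lemma nn_integral_floor_step:
  fixes \<phi> :: "int \<Rightarrow> ennreal" and N :: nat
  assumes N: "N > 0" and X: "finite X" and \<phi>: "\<And>u. u \<notin> X \<Longrightarrow> \<phi> u = 0"
  shows "(\<integral>\<^sup>+x. \<phi> \<lfloor>real N * x\<rfloor> \<partial>lborel) = ennreal (1 / real N) * (\<Sum>u\<in>X. \<phi> u)"
proof -
  define I where "I u = {of_int u / real N ..< (of_int u + 1) / real N}" for u
  have I: "x \<in> I u \<longleftrightarrow> \<lfloor>real N * x\<rfloor> = u" for x u
    using N by (simp add: I_def floor_eq_iff field_simps)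
  have "\<phi> \<lfloor>real N * x\<rfloor> = (\<Sum>u\<in>X. \<phi> u * indicator (I u) x)" for x
  proof -
    have "(\<Sum>u\<in>X. \<phi> u * indicator (I u) x) = (\<Sum>u\<in>X. if \<lfloor>real N * x\<rfloor> = u then \<phi> u else 0)"
      by (intro sum.cong refl) (auto simp: indicator_def I)
    then show ?thesis using X \<phi> by simp
  qed
  then have "(\<integral>\<^sup>+x. \<phi> \<lfloor>real N * x\<rfloor> \<partial>lborel) = (\<Sum>u\<in>X. \<integral>\<^sup>+x. \<phi> u * indicator (I u) x \<partial>lborel)"
    by (simp add: I_def nn_integral_sum)
  also have "\<dots> = (\<Sum>u\<in>X. \<phi> u * ennreal (1 / real N))"
  proof (rule sum.cong[OF refl])
    fix u
    have "emeasure lborel (I u) = ennreal (1 / real N)"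
      unfolding I_def using N by (subst emeasure_lborel_Ico) (auto simp: divide_simps)
    then show "(\<integral>\<^sup>+x. \<phi> u * indicator (I u) x \<partial>lborel) = \<phi> u * ennreal (1 / real N)"
      by (subst nn_integral_cmult_indicator) (auto simp: I_def)
  qed
  finally show ?thesis by (simp add: sum_distrib_right mult.commute)
qed

text \<open>Each x lies within 1/N of the grid point of its cell, so the infimum over the larger
  ball is at most \<open>G x\<close>. The balls overlap, but each value is integrated only over its
  own cell of length 1/N, so no factor \<open>K\<close> is lost.\<close>

lemma grid_inf_sum_le:
  fixes G :: "real \<Rightarrow> ennreal" and N :: nat
  assumes N: "N > 0" and X: "finite X" and K: "K \<ge> 1"
  shows "ennreal (1 / real N) * (\<Sum>n\<in>X. INF t\<in>cball (of_int n / real N) (K / real N). G t)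
    \<le> (\<integral>\<^sup>+t. G t \<partial>lborel)"
proof -
  define \<phi> where "\<phi> n = (if n \<in> X then INF t\<in>cball (of_int n / real N) (K / real N). G t else 0)" for n
  have "ennreal (1 / real N) * (\<Sum>n\<in>X. INF t\<in>cball (of_int n / real N) (K / real N). G t)
      = (\<integral>\<^sup>+x. \<phi> \<lfloor>real N * x\<rfloor> \<partial>lborel)"
    using N X by (subst nn_integral_floor_step[where X = X]) (auto simp: \<phi>_def)
  also have "\<dots> \<le> (\<integral>\<^sup>+t. G t \<partial>lborel)"
  proof (rule nn_integral_mono)
    fix x :: real
    let ?n = "\<lfloor>real N * x\<rfloor>"
    have "\<bar>real N * x - of_int ?n\<bar> \<le> K" using K by linarith
    then have "\<bar>real N * x - of_int ?n\<bar> / real N \<le> K / real N"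
      using N by (simp add: divide_right_mono)
    moreover have "\<bar>real N * x - of_int ?n\<bar> / real N = \<bar>of_int ?n / real N - x\<bar>"
      using N by (subst abs_minus_commute) (simp add: abs_if field_simps)
    ultimately have "x \<in> cball (of_int ?n / real N) (K / real N)"
      by (simp add: dist_real_def)
    then show "\<phi> ?n \<le> G x" by (auto simp: \<phi>_def intro: INF_lower)
  qed
  finally show ?thesis .
qed

lemma eventually_grid_inf_ge:
  fixes G :: "real \<Rightarrow> ennreal"
  assumes G: "open {t. c < G t}" and t: "c < G t"
  shows "eventually (\<lambda>N. \<forall>n::int. \<bar>real N * t - of_int n\<bar> \<le> K \<longrightarrow>
    c \<le> (INF s\<in>cball (of_int n / real N) (K / real N). G s)) sequentially"
proof -
  obtain \<delta> where \<delta>: "\<delta> > 0" "ball t \<delta> \<subseteq> {t. c < G t}"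
    using G t open_contains_ball by blast
  have "eventually (\<lambda>N. real N > 2 * K / \<delta>) sequentially"
    using filterlim_real_sequentially by (rule filterlim_at_top_dense[THEN iffD1, rule_format])
  then show ?thesis
    using eventually_gt_at_top[of 0]
  proof eventually_elim
    case (elim N)
    show ?case
    proof (intro allI impI INF_greatest)
      fix n :: int and s
      assume n: "\<bar>real N * t - of_int n\<bar> \<le> K" and s: "s \<in> cball (of_int n / real N) (K / real N)"
      have "\<bar>t - of_int n / real N\<bar> = \<bar>real N * t - of_int n\<bar> / real N"
        using elim by (simp add: abs_if field_simps)
      also have "\<dots> \<le> K / real N" using n by (simp add: divide_right_mono)
      finally have "\<bar>t - s\<bar> \<le> 2 * K / real N" using s by (simp add: dist_real_def)
      also have "\<dots> < \<delta>" using elim \<delta>(1) by (simp add: field_simps)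
      finally show "c \<le> G s" using \<delta>(2) by (auto simp: dist_real_def subset_iff intro: less_imp_le)
    qed
  qed
qed

lemma measurable_step_function [measurable]:
  fixes \<phi> :: "int \<Rightarrow> 'a::topological_space"
  shows "(\<lambda>x::real. \<phi> \<lfloor>a * x\<rfloor>) \<in> borel_measurable borel"
  by (rule measurable_compose[where g = \<phi> and N = "count_space UNIV"]) measurable

text \<open>The discrete inequality is applied to the cell infima of \<open>G j\<close> on a finite
  grid. It bounds the mixed integral of a step function \<open>H k\<close> uniformly in k, and the
  lower limit of \<open>H k\<close> dominates the integrand.\<close>

lemma strong_type_of_discrete:
  fixes g :: "nat \<Rightarrow> real \<Rightarrow> real" and G :: "nat \<Rightarrow> real \<Rightarrow> ennreal"
  assumes discrete: "\<And>X (N :: nat \<Rightarrow> int set) (f :: nat \<Rightarrow> int \<Rightarrow> real). finite X \<Longrightarrow>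
      (\<And>j. j \<in> {1..m} \<Longrightarrow> finite (N j)) \<Longrightarrow>
      (\<And>x y j. x \<in> X \<Longrightarrow> y \<in> X \<Longrightarrow> j \<in> {1..m} \<Longrightarrow> P j * x + Q j * y \<in> N j) \<Longrightarrow>
      (\<And>j n. f j n \<ge> 0) \<Longrightarrow>
      (\<Sum>x\<in>X. (\<Sum>y\<in>X. \<Prod>j=1..m. f j (P j * x + Q j * y) powr (p j * r)) powr (q / r))
        \<le> (\<Prod>j=1..m. (\<Sum>n\<in>N j. f j n) powr (p j * q))"
    and q: "q > 0" and r: "r > 0" and qr: "1 / q + 1 / r = 1"
    and p: "\<And>j. j \<in> {1..m} \<Longrightarrow> p j > 0" and psum: "(\<Sum>j=1..m. p j) = 1"
    and Q: "\<And>j. j \<in> {1..m} \<Longrightarrow> Q j \<noteq> 0"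
    and G: "\<And>j c. j \<in> {1..m} \<Longrightarrow> open {t. c < G j t}"
    and gG: "\<And>j t. j \<in> {1..m} \<Longrightarrow> ennreal (g j t) \<le> G j t"
    and g: "\<And>j t. j \<in> {1..m} \<Longrightarrow> g j t \<ge> 0"
    and J: "\<And>j. j \<in> {1..m} \<Longrightarrow> (\<integral>\<^sup>+t. G j t \<partial>lborel) \<le> ennreal (J j)"
    and J0: "\<And>j. j \<in> {1..m} \<Longrightarrow> J j \<ge> 0"
  shows "(\<integral>\<^sup>+x. ennpowr (\<integral>\<^sup>+y. ennreal (\<Prod>j=1..m. g j (real_of_int (P j) * x + real_of_int (Q j) * y) powr (p j * r)) \<partial>lborel)
      (q / r) \<partial>lborel) \<le> ennreal (\<Prod>j=1..m. J j powr (p j * q))"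
proof -
  define s where "s = q / r"
  have s: "s > 0" using q r by (simp add: s_def)
  have s1: "1 + s = q" using qr q r by (simp add: s_def field_simps)
  \<comment> \<open>Rounding N x and N y down, each with error at most 1, moves P_j x + Q_j y by at
    most \<open>K j / N\<close>.\<close>
  define K where "K j = real_of_int (\<bar>P j\<bar> + \<bar>Q j\<bar>)" for j
  have K1: "K j \<ge> 1" if "j \<in> {1..m}" for j
  proof -
    have "1 \<le> \<bar>P j\<bar> + \<bar>Q j\<bar>" using Q[OF that] by linarith
    then show ?thesis unfolding K_def by linarith
  qed
  define cell where "cell N j n = (INF t\<in>cball (of_int n / real N) (K j / real N). G j t)"
    for N :: nat and j and n :: int
  define a where "a N j n = enn2real (cell N j n)" for N j n
  have a0: "a N j n \<ge> 0" for N j n by (simp add: a_def)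
  have cell_sum: "ennreal (1 / real N) * (\<Sum>n\<in>X. cell N j n) \<le> ennreal (J j)"
    if "N > 0" "finite X" "j \<in> {1..m}" for N j X
    unfolding cell_def using grid_inf_sum_le[OF that(1,2) K1[OF that(3)]] J[OF that(3)] by (rule order_trans)
  \<comment> \<open>A single cell is bounded by N \<open>J j\<close>, so it is finite and
    \<open>enn2real\<close> loses nothing.\<close>
  have cell_a: "cell N j n = ennreal (a N j n)" if "N > 0" "j \<in> {1..m}" for N j n
  proof -
    have "ennreal (1 / real N) * cell N j n \<le> ennreal (J j)"
      using cell_sum[of N "{n}" j] that by simp
    then have "cell N j n \<noteq> \<infinity>"
      using that by (auto simp: ennreal_mult_top top_unique)
    then show ?thesis unfolding a_def by (simp add: less_top)
  qed
  have a_sum: "(\<Sum>n\<in>X. a N j n) / real N \<le> J j" if "N > 0" "finite X" "j \<in> {1..m}" for N j X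
  proof -
    have "ennreal (1 / real N) * (\<Sum>n\<in>X. cell N j n) = ennreal (1 / real N) * ennreal (\<Sum>n\<in>X. a N j n)"
      using cell_a[OF that(1,3)] a0 by (simp add: sum_ennreal)
    also have "\<dots> = ennreal ((\<Sum>n\<in>X. a N j n) / real N)"
      using a0 by (subst ennreal_mult[symmetric]) (auto intro: sum_nonneg)
    finally show ?thesis using cell_sum[OF that] J0[OF that(3)] by simp
  qed
  \<comment> \<open>Indices up to N^2 at mesh 1/N reach out to distance N: the grid is finite at
    each stage yet exhausts the plane.\<close>
  define X where "X N = {- int (N\<^sup>2)..int (N\<^sup>2)}" for N :: nat
  define h where "h N u v = (if u \<in> X N \<and> v \<in> X N
    then \<Prod>j=1..m. a N j (P j * u + Q j * v) powr (p j * r) else 0)" for N u v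
  have h0: "h N u v \<ge> 0" for N u v unfolding h_def by (auto intro!: prod_nonneg)
  define H where "H k x y = ennreal (h (Suc k) \<lfloor>real (Suc k) * x\<rfloor> \<lfloor>real (Suc k) * y\<rfloor>)" for k x y
  define W where "W N u = (\<Sum>v\<in>X N. h N u v) / real N" for N u
  have W0: "W N u \<ge> 0" for N u unfolding W_def using h0 by (auto intro!: divide_nonneg_nonneg sum_nonneg)
  have finX: "finite (X N)" for N by (simp add: X_def)
  have ev_X: "eventually (\<lambda>k. \<lfloor>real (Suc k) * x\<rfloor> \<in> X (Suc k)) sequentially" for x :: real
  proof -
    have "eventually (\<lambda>k. real (Suc k) \<ge> \<bar>x\<bar> + 1) sequentially"
      using filterlim_real_sequentially
      by (subst eventually_sequentially_Suc) (auto simp: filterlim_at_top)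
    then show ?thesis
    proof eventually_elim
      case (elim k)
      let ?N = "real (Suc k)"
      have "\<bar>?N * x\<bar> + 1 \<le> ?N * \<bar>x\<bar> + ?N" by (simp add: abs_mult)
      also have "\<dots> = ?N * (\<bar>x\<bar> + 1)" by (simp add: algebra_simps)
      also have "\<dots> \<le> ?N * ?N" using elim by (intro mult_left_mono) auto
      also have "\<dots> = real_of_int (int ((Suc k)\<^sup>2))" by (simp add: power2_eq_square algebra_simps)
      finally have *: "\<bar>?N * x\<bar> + 1 \<le> real_of_int (int ((Suc k)\<^sup>2))" .
      show ?case unfolding X_def atLeastAtMost_iff using * by linarith
    qed
  qed
  have pointwise: "ennreal (\<Prod>j=1..m. g j (real_of_int (P j) * x + real_of_int (Q j) * y) powr (p j * r)) \<le> liminf (\<lambda>k. H k x y)"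
    for x y :: real
  proof -
    define n where "n k j = P j * \<lfloor>real (Suc k) * x\<rfloor> + Q j * \<lfloor>real (Suc k) * y\<rfloor>" for k j
    define t where "t j = real_of_int (P j) * x + real_of_int (Q j) * y" for j
    \<comment> \<open>The cell infima may stay above \<open>g j\<close>, since \<open>G j\<close> is
      only a majorant. Truncation at \<open>g j\<close> yields a genuine limit and still a lower
      bound for the factors of \<open>H\<close>.\<close>
    define b where "b k j = min (a (Suc k) j (n k j)) (g j (t j))" for k j
    have frac: "\<bar>z - of_int \<lfloor>z\<rfloor>\<bar> \<le> 1" for z :: real by linarith
    have near: "\<bar>real (Suc k) * t j - of_int (n k j)\<bar> \<le> K j" for k j
    proof -
      let ?N = "real (Suc k)"
      have "?N * t j - of_int (n k j)
          = of_int (P j) * (?N * x - of_int \<lfloor>?N * x\<rfloor>) + of_int (Q j) * (?N * y - of_int \<lfloor>?N * y\<rfloor>)"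
        unfolding t_def n_def by (simp add: algebra_simps)
      also have "\<bar>\<dots>\<bar> \<le> \<bar>of_int (P j)\<bar> * \<bar>?N * x - of_int \<lfloor>?N * x\<rfloor>\<bar> + \<bar>of_int (Q j)\<bar> * \<bar>?N * y - of_int \<lfloor>?N * y\<rfloor>\<bar>"
        by (rule order_trans[OF abs_triangle_ineq]) (simp add: abs_mult)
      also have "\<dots> \<le> \<bar>of_int (P j)\<bar> * 1 + \<bar>of_int (Q j)\<bar> * 1"
        by (intro add_mono mult_left_mono frac) auto
      finally show ?thesis by (simp add: K_def)
    qed
    have b0: "b k j \<ge> 0" if "j \<in> {1..m}" for k j using a0 g[OF that] by (simp add: b_def)
    have lim_b: "(\<lambda>k. b k j) \<longlonglongrightarrow> g j (t j)" if j: "j \<in> {1..m}" for j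
    proof (rule order_tendstoI)
      fix c assume "c < g j (t j)"
      \<comment> \<open>The intermediate value restores strictness, as the infimum gives only a weak
        inequality. A nonpositive \<open>c'\<close> is treated apart because \<open>ennreal\<close>
        truncates negative numbers to 0.\<close>
      then obtain c' where c': "c < c'" "c' < g j (t j)" using dense by blast
      show "eventually (\<lambda>k. c < b k j) sequentially"
      proof (cases "c' > 0")
        case True
        have "ennreal c' < ennreal (g j (t j))" using c' True by (simp add: ennreal_lessI)
        also have "\<dots> \<le> G j (t j)" by (rule gG[OF j])
        finally have "eventually (\<lambda>N. \<forall>n::int. \<bar>real N * t j - of_int n\<bar> \<le> K j \<longrightarrow>
            ennreal c' \<le> cell N j n) sequentially"
          unfolding cell_def by (intro eventually_grid_inf_ge G[OF j])
        then have "eventually (\<lambda>k. \<forall>n::int. \<bar>real (Suc k) * t j - of_int n\<bar> \<le> K j \<longrightarrow>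
            ennreal c' \<le> cell (Suc k) j n) sequentially"
          by (subst eventually_sequentially_Suc)
        then show ?thesis
        proof eventually_elim
          case (elim k)
          then have "ennreal c' \<le> ennreal (a (Suc k) j (n k j))"
            using near[of k j] cell_a[OF _ j] by simp
          then have "c' \<le> a (Suc k) j (n k j)" using a0 by simp
          then show ?case using c' by (simp add: b_def)
        qed
      next
        case False
        then have "c < b k j" for k using c' b0[OF j, of k] by linarith
        then show ?thesis by simp
      qed
    next
      fix c assume "g j (t j) < c"
      then show "eventually (\<lambda>k. b k j < c) sequentially" by (simp add: b_def min_less_iff_disj)
    qed
    have "(\<lambda>k. ennreal (\<Prod>j=1..m. b k j powr (p j * r))) \<longlonglongrightarrow> ennreal (\<Prod>j=1..m. g j (t j) powr (p j * r))"
      using lim_b b0 p r by (intro tendsto_ennrealI tendsto_prod tendsto_powr') auto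
    then have "ennreal (\<Prod>j=1..m. g j (t j) powr (p j * r)) = liminf (\<lambda>k. ennreal (\<Prod>j=1..m. b k j powr (p j * r)))"
      by (intro lim_imp_Liminf[symmetric]) auto
    also have "\<dots> \<le> liminf (\<lambda>k. H k x y)"
    proof (rule Liminf_mono)
      show "eventually (\<lambda>k. ennreal (\<Prod>j=1..m. b k j powr (p j * r)) \<le> H k x y) sequentially"
        using ev_X[of x] ev_X[of y]
      proof eventually_elim
        case (elim k)
        have "(\<Prod>j=1..m. b k j powr (p j * r)) \<le> (\<Prod>j=1..m. a (Suc k) j (n k j) powr (p j * r))"
        proof (intro prod_mono conjI powr_mono2)
          fix j assume j: "j \<in> {1..m}"
          show "0 \<le> p j * r" using p[OF j] r by simp
          show "0 \<le> b k j" by (rule b0[OF j])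
          show "b k j \<le> a (Suc k) j (n k j)" by (simp add: b_def)
        qed simp
        then show ?case
          using elim unfolding H_def h_def n_def by (simp add: ennreal_leI)
      qed
    qed
    finally show ?thesis unfolding t_def .
  qed
  have inner: "(\<integral>\<^sup>+y. H k x y \<partial>lborel) = ennreal (W (Suc k) \<lfloor>real (Suc k) * x\<rfloor>)" for k x
  proof -
    let ?N = "Suc k" and ?u = "\<lfloor>real (Suc k) * x\<rfloor>"
    have "(\<integral>\<^sup>+y. H k x y \<partial>lborel) = ennreal (1 / real ?N) * (\<Sum>v\<in>X ?N. ennreal (h ?N ?u v))"
      unfolding H_def by (rule nn_integral_floor_step[OF _ finX]) (auto simp: h_def)
    also have "\<dots> = ennreal (1 / real ?N) * ennreal (\<Sum>v\<in>X ?N. h ?N ?u v)"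
      using h0 by (simp add: sum_ennreal)
    also have "\<dots> = ennreal (W ?N ?u)"
      unfolding W_def using h0 by (subst ennreal_mult[symmetric]) (auto intro: sum_nonneg)
    finally show ?thesis .
  qed
  have step_bound: "(\<integral>\<^sup>+x. ennpowr (\<integral>\<^sup>+y. H k x y \<partial>lborel) s \<partial>lborel) \<le> ennreal (\<Prod>j=1..m. J j powr (p j * q))"
    for k
  proof -
    define N where "N = Suc k"
    have N: "N > 0" by (simp add: N_def)
    define R where "R j = (\<lambda>(u, v). P j * u + Q j * v) ` (X N \<times> X N)" for j
    have finR: "finite (R j)" for j unfolding R_def using finX by auto
    have "(\<integral>\<^sup>+x. ennpowr (\<integral>\<^sup>+y. H k x y \<partial>lborel) s \<partial>lborel)
        = (\<integral>\<^sup>+x. ennreal (W N \<lfloor>real N * x\<rfloor> powr s) \<partial>lborel)"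
      unfolding inner N_def by (simp add: ennpowr_ennreal W0)
    also have "\<dots> = ennreal (1 / real N) * (\<Sum>u\<in>X N. ennreal (W N u powr s))"
      by (rule nn_integral_floor_step[OF N finX]) (auto simp: W_def h_def)
    also have "\<dots> = ennreal ((\<Sum>u\<in>X N. W N u powr s) / real N)"
      by (simp add: sum_ennreal sum_nonneg flip: ennreal_mult)
    \<comment> \<open>The outer 1/N and the inner (1/N)^s combine to N^(-q); below, this is shared
      among the factors as the product of N^(-p_j q).\<close>
    also have "(\<Sum>u\<in>X N. W N u powr s) / real N
        = (\<Sum>u\<in>X N. (\<Sum>v\<in>X N. h N u v) powr s) / real N powr q"
      unfolding W_def s1[symmetric] using N h0
      by (simp add: powr_divide sum_nonneg powr_add sum_divide_distrib[symmetric] mult.commute)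
    also have "(\<Sum>u\<in>X N. (\<Sum>v\<in>X N. h N u v) powr s)
        = (\<Sum>u\<in>X N. (\<Sum>v\<in>X N. \<Prod>j=1..m. a N j (P j * u + Q j * v) powr (p j * r)) powr (q / r))"
      unfolding s_def by (intro sum.cong refl arg_cong2[where f = "(powr)"]) (simp add: h_def)
    also have "\<dots> \<le> (\<Prod>j=1..m. (\<Sum>n\<in>R j. a N j n) powr (p j * q))"
      using finX finR a0 by (intro discrete) (auto simp: R_def)
    also have "(\<Prod>j=1..m. (\<Sum>n\<in>R j. a N j n) powr (p j * q)) / real N powr q
        = (\<Prod>j=1..m. ((\<Sum>n\<in>R j. a N j n) / real N) powr (p j * q))"
    proof -
      have "real N powr q = real N powr (\<Sum>j=1..m. p j * q)"
        using psum by (simp flip: sum_distrib_right)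
      also have "\<dots> = (\<Prod>j=1..m. real N powr (p j * q))"
        using N by (simp add: powr_sum)
      finally show ?thesis
        using a0 by (simp add: powr_divide sum_nonneg prod_dividef)
    qed
    also have "\<dots> \<le> (\<Prod>j=1..m. J j powr (p j * q))"
    proof (intro prod_mono conjI powr_mono2)
      fix j assume j: "j \<in> {1..m}"
      show "0 \<le> p j * q" using p[OF j] q by simp
      show "0 \<le> (\<Sum>n\<in>R j. a N j n) / real N" using a0 by (auto intro!: divide_nonneg_nonneg sum_nonneg)
      show "(\<Sum>n\<in>R j. a N j n) / real N \<le> J j" by (rule a_sum[OF N finR j])
    qed simp
    finally show ?thesis by (simp add: ennreal_leI divide_right_mono)
  qed
  \<comment> \<open>Fatou's lemma is used twice, in y here and in x afterwards, both times for step
    functions; the original integrand enters through monotonicity alone.\<close>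
  have "(\<integral>\<^sup>+x. ennpowr (\<integral>\<^sup>+y. ennreal (\<Prod>j=1..m. g j (real_of_int (P j) * x + real_of_int (Q j) * y) powr (p j * r)) \<partial>lborel) s \<partial>lborel)
      \<le> (\<integral>\<^sup>+x. liminf (\<lambda>k. ennpowr (\<integral>\<^sup>+y. H k x y \<partial>lborel) s) \<partial>lborel)"
  proof (rule nn_integral_mono)
    fix x
    have "(\<integral>\<^sup>+y. ennreal (\<Prod>j=1..m. g j (real_of_int (P j) * x + real_of_int (Q j) * y) powr (p j * r)) \<partial>lborel)
        \<le> (\<integral>\<^sup>+y. liminf (\<lambda>k. H k x y) \<partial>lborel)"
      by (intro nn_integral_mono pointwise)
    also have "\<dots> \<le> liminf (\<lambda>k. \<integral>\<^sup>+y. H k x y \<partial>lborel)"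
      unfolding H_def by (intro nn_integral_liminf) simp
    finally show "ennpowr (\<integral>\<^sup>+y. ennreal (\<Prod>j=1..m. g j (real_of_int (P j) * x + real_of_int (Q j) * y) powr (p j * r)) \<partial>lborel) s
        \<le> liminf (\<lambda>k. ennpowr (\<integral>\<^sup>+y. H k x y \<partial>lborel) s)"
      unfolding liminf_ennpowr[OF s] using s by (rule ennpowr_mono)
  qed
  also have "\<dots> \<le> liminf (\<lambda>k. \<integral>\<^sup>+x. ennpowr (\<integral>\<^sup>+y. H k x y \<partial>lborel) s \<partial>lborel)"
    unfolding inner
    by (intro nn_integral_liminf)
      (simp add: measurable_step_function[where \<phi> = "\<lambda>u. ennpowr (ennreal (W _ u)) s"])
  also have "\<dots> \<le> liminf (\<lambda>k::nat. ennreal (\<Prod>j=1..m. J j powr (p j * q)))"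
    by (intro Liminf_mono always_eventually allI step_bound)
  also have "\<dots> = ennreal (\<Prod>j=1..m. J j powr (p j * q))"
    by (simp add: Liminf_const)
  finally show ?thesis unfolding s_def .
qed

theorem theorem3p3:
  fixes m :: nat and p :: "nat \<Rightarrow> real" and q r :: real and P Q :: "nat \<Rightarrow> int"
  assumes "m \<ge> 1"
    and "\<And>j. j \<in> {1..m} \<Longrightarrow> p j > 0"
    and "q > 0" and "r > 0"
    and "1 / q + 1 / r = 1"
    and "(\<Sum>j=1..m. p j) = 1"
    and "\<And>j. j \<in> {1..m} \<Longrightarrow> coprime (P j) (Q j)"
    and "\<And>j. j \<in> {1..m} \<Longrightarrow> Q j \<noteq> 0"
    and "uniform_restricted_weak_type TYPE('g::infinite) m p q r P Q"
  shows "\<exists>C::real. C \<ge> 0 \<and>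
    (\<forall>f :: nat \<Rightarrow> real \<Rightarrow> real.
       (\<forall>j\<in>{1..m}. integrable lebesgue (f j) \<and> (\<forall>t. f j t \<ge> 0)) \<longrightarrow>
       mixed_norm q r (\<lambda>x y. \<Prod>j=1..m. f j (line_proj (P j) (Q j) x y) powr p j)
         \<le> ennreal (C * (\<Prod>j=1..m. L1_norm (f j) powr p j)))"
proof -
  note p = assms(2) and q = assms(3) and r = assms(4) and qr = assms(5) and psum = assms(6)
    and Q = assms(8)
  obtain C0 where C0: "\<And>G :: 'g monoid. torsion_free_abelian G \<Longrightarrow> restricted_weak_type G m p q r P Q C0"
    using assms(9) unfolding uniform_restricted_weak_type_def by blast
  have "countable (carrier (int_power_group n))" for n
    unfolding carrier_int_power_group by (intro countable_PiE) auto
  then have rwt: "restricted_weak_type (int_power_group n) m p q r P Q C0" for n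
    by (intro restricted_weak_type_countable[OF C0 torsion_free_abelian_int_power_group])
  define s where "s j = sqrt ((real_of_int (P j))\<^sup>2 + (real_of_int (Q j))\<^sup>2)" for j
  have s0: "s j > 0" if "j \<in> {1..m}" for j
    using Q[OF that] by (simp add: s_def add_nonneg_pos)
  \<comment> \<open>The factor \<open>s j\<close> is the Jacobian of t -> t / s_j, which turns
    \<open>line_proj\<close> into the integral form P_j x + Q_j y.\<close>
  define C where "C = (\<Prod>j=1..m. (2 * s j) powr p j)"
  have C: "C \<ge> 0" unfolding C_def by (intro prod_nonneg) auto
  have "mixed_norm q r (\<lambda>x y. \<Prod>j=1..m. f j (line_proj (P j) (Q j) x y) powr p j)
      \<le> ennreal (C * (\<Prod>j=1..m. L1_norm (f j) powr p j))"
    if f: "\<forall>j\<in>{1..m}. integrable lebesgue (f j) \<and> (\<forall>t. f j t \<ge> 0)" for f :: "nat \<Rightarrow> real \<Rightarrow> real"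
  proof -
    define I where "I j = (LINT t|lebesgue. f j t)" for j
    have I0: "I j \<ge> 0" if "j \<in> {1..m}" for j
      unfolding I_def using f that by (intro Bochner_Integration.integral_nonneg) auto
    have I: "L1_norm (f j) = I j" if "j \<in> {1..m}" for j
      unfolding L1_norm_def I_def using f that by (intro Bochner_Integration.integral_cong) auto
    have bound: "mixed_norm q r (\<lambda>x y. \<Prod>j=1..m. f j (line_proj (P j) (Q j) x y) powr p j)
        \<le> ennreal (\<Prod>j=1..m. (s j * (2 * I j + e)) powr p j)" if e: "e > 0" for e
    proof -
      have "\<exists>G. (\<forall>c. open {t. c < G t}) \<and> (\<forall>t. ennreal (f j t) \<le> G t) \<and>
          (\<integral>\<^sup>+t. G t \<partial>lborel) \<le> ennreal (2 * I j + e)" if "j \<in> {1..m}" for j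
        using f that e unfolding I_def by (metis lsc_majorant)
      then obtain G :: "nat \<Rightarrow> real \<Rightarrow> ennreal" where
        G: "\<And>j c. j \<in> {1..m} \<Longrightarrow> open {t. c < G j t}"
          "\<And>j t. j \<in> {1..m} \<Longrightarrow> ennreal (f j t) \<le> G j t"
          "\<And>j. j \<in> {1..m} \<Longrightarrow> (\<integral>\<^sup>+t. G j t \<partial>lborel) \<le> ennreal (2 * I j + e)"
        by metis
      define J where "J j = s j * (2 * I j + e)" for j
      define E where "E = (\<integral>\<^sup>+x. ennpowr (\<integral>\<^sup>+y. ennreal (\<Prod>j=1..m.
        f j ((real_of_int (P j) * x + real_of_int (Q j) * y) / s j) powr (p j * r)) \<partial>lborel) (q / r) \<partial>lborel)"
      have J0: "J j \<ge> 0" if "j \<in> {1..m}" for j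
        using s0[OF that] I0[OF that] e by (simp add: J_def)
      have G_open: "open {t. c < G j (t / s j)}" if j: "j \<in> {1..m}" for j and c :: ennreal
      proof -
        have "continuous_on UNIV (\<lambda>t. t / s j)"
          using s0[OF j] by (intro continuous_intros) auto
        then have "open ((\<lambda>t. t / s j) -` {t. c < G j t})" by (intro open_vimage G(1)[OF j])
        then show ?thesis by (simp add: vimage_def)
      qed
      have G_int: "(\<integral>\<^sup>+t. G j (t / s j) \<partial>lborel) \<le> ennreal (J j)" if j: "j \<in> {1..m}" for j
      proof -
        have Gm: "G j \<in> borel_measurable borel"
        proof (rule borel_measurableI_greater)
          fix c
          have "{t. c < G j t} \<in> sets borel" by (rule borel_open) (rule G(1)[OF j])
          then show "{t \<in> space borel. c < G j t} \<in> sets borel"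
            by (simp only: space_borel UNIV_I simp_thms)
        qed
        have "(\<integral>\<^sup>+t. G j (t / s j) \<partial>lborel) = ennreal \<bar>s j\<bar> * (\<integral>\<^sup>+t. G j ((0 + s j * t) / s j) \<partial>lborel)"
          using s0[OF j] Gm by (intro nn_integral_real_affine) auto
        also have "\<dots> = ennreal (s j) * (\<integral>\<^sup>+t. G j t \<partial>lborel)"
          using s0[OF j] by simp
        also have "\<dots> \<le> ennreal (s j) * ennreal (2 * I j + e)"
          by (intro mult_left_mono G(3)[OF j]) auto
        also have "\<dots> = ennreal (J j)"
          unfolding J_def using s0[OF j] I0[OF j] e by (intro ennreal_mult[symmetric]) auto
        finally show ?thesis .
      qed
      have disc: "(\<Sum>x\<in>X. (\<Sum>y\<in>X. \<Prod>j=1..m. h j (P j * x + Q j * y) powr (p j * r)) powr (q / r))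
          \<le> (\<Prod>j=1..m. (\<Sum>n\<in>N j. h j n) powr (p j * q))"
        if "finite X" "\<And>j. j \<in> {1..m} \<Longrightarrow> finite (N j)"
          "\<And>x y j. x \<in> X \<Longrightarrow> y \<in> X \<Longrightarrow> j \<in> {1..m} \<Longrightarrow> P j * x + Q j * y \<in> N j"
          "\<And>j n. h j n \<ge> 0"
        for X :: "int set" and N and h :: "nat \<Rightarrow> int \<Rightarrow> real"
        by (rule discrete_strong_type[OF rwt q r p that(1,1,2,3,4)])
      have "E \<le> ennreal (\<Prod>j=1..m. J j powr (p j * q))"
        unfolding E_def
        by (rule strong_type_of_discrete[where G = "\<lambda>j t. G j (t / s j)" and g = "\<lambda>j t. f j (t / s j)",
              OF disc q r qr p psum Q G_open G(2) _ G_int J0])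
          (use f in auto)
      \<comment> \<open>Nonnegative integrals over \<open>lebesgue\<close> and \<open>lborel\<close>
        agree, the former being the completion of the latter.\<close>
      moreover have "mixed_norm q r (\<lambda>x y. \<Prod>j=1..m. f j (line_proj (P j) (Q j) x y) powr p j)
          = ennpowr E (1 / q)"
      proof -
        have "\<bar>\<Prod>j=1..m. f j (line_proj (P j) (Q j) x y) powr p j\<bar> powr r
          = (\<Prod>j=1..m. f j ((real_of_int (P j) * x + real_of_int (Q j) * y) / s j) powr (p j * r))" for x y
          by (simp add: line_proj_def s_def prod_nonneg prod_powr_distrib powr_powr)
        then show ?thesis
          unfolding mixed_norm_def E_def by (simp add: nn_integral_completion)
      qed
      ultimately have "mixed_norm q r (\<lambda>x y. \<Prod>j=1..m. f j (line_proj (P j) (Q j) x y) powr p j)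
          \<le> ennpowr (ennreal (\<Prod>j=1..m. J j powr (p j * q))) (1 / q)"
        using q by (simp add: ennpowr_mono)
      also have "\<dots> = ennreal (\<Prod>j=1..m. J j powr p j)"
        using q by (simp add: ennpowr_ennreal prod_nonneg prod_powr_distrib powr_powr)
      finally show ?thesis by (simp add: J_def)
    qed
    \<comment> \<open>The additive error e cannot be absorbed into a multiple of \<open>I j\<close>
      when \<open>I j = 0\<close>, so it is sent to 0; \<open>C\<close> is independent of
      it.\<close>
    have "(\<lambda>n. (s j * (2 * I j + inverse (real (Suc n)))) powr p j) \<longlonglongrightarrow> (s j * (2 * I j + 0)) powr p j"
      if j: "j \<in> {1..m}" for j
      using p[OF j] s0[OF j] I0[OF j]
      by (intro tendsto_powr' tendsto_intros LIMSEQ_inverse_real_of_nat) auto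
    then have "(\<lambda>n. ennreal (\<Prod>j=1..m. (s j * (2 * I j + inverse (real (Suc n)))) powr p j))
        \<longlonglongrightarrow> ennreal (\<Prod>j=1..m. (s j * (2 * I j + 0)) powr p j)"
      by (intro tendsto_ennrealI tendsto_prod)
    then have "mixed_norm q r (\<lambda>x y. \<Prod>j=1..m. f j (line_proj (P j) (Q j) x y) powr p j)
        \<le> ennreal (\<Prod>j=1..m. (s j * (2 * I j + 0)) powr p j)"
      by (rule LIMSEQ_le_const) (intro exI allI impI bound, simp)
    also have "(\<Prod>j=1..m. (s j * (2 * I j + 0)) powr p j) = C * (\<Prod>j=1..m. L1_norm (f j) powr p j)"
      unfolding C_def prod.distrib[symmetric] using I s0 I0
      by (intro prod.cong refl) (simp add: mult_ac flip: powr_mult)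
    finally show ?thesis .
  qed
  with C show ?thesis by blast
qed

end
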